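(* Let $m$ be a non-zero constant and consider, in the coordinates $(x^1,x^2,x^3,x^4)=(u,r,\theta,\phi)$ with $r>0$, the Schwarzschild metric $$g=-\left(1-\frac{2m}{r}\right)du^2-2\,dr\,du+r^2\left(d\theta^2+\sin^2\theta\,d\phi^2\right).$$ Let $R,S,\kappa$ be its Riemann-Christoffel curvature tensor, Ricci tensor and scalar curvature, and let $P,W,C,K$ be its projective, concircular, conformal and conharmonic curvature tensors (conventions as in the context). The Schwarzschild metric possesses the following curvature properties: (i) It is Ricci flat ($S=0$), and hence $R=P=W=C=K$. (ii) It is harmonic, i.e. $\operatorname{div}R=0$. (iii) It is Deszcz pseudosymmetric, satisfying $R\cdot R=\frac{m}{r^3}Q(g,R)$. (iv) The general form of the compatible tensors for $R$ is given by $$\left(\begin{array}{cccc} a_{11}&a_{12}&0&0\\ a_{12}&a_{22}&0&0\\ 0&0&a_{33}&a_{34}\\ 0&0&a_{34}&a_{44}\end{array}\right),$$ where the $a_{ij}$ are arbitrary scalars.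
   Context: Here $n=\dim M=4$, $\nabla$ is the Levi-Civita connection, "scalar" means smooth function, and $X,Y,X_1,X_2,\dots$ are vector fields. Curvature sign convention: $\mathcal R(X,Y)Z=\nabla_{[X,Y]}Z-\nabla_X\nabla_YZ+\nabla_Y\nabla_XZ$, $R(X_1,X_2,X_3,X_4)=g(\mathcal R(X_1,X_2)X_3,X_4)$, $S_{jk}=g^{il}R_{ijkl}$, $\kappa=g^{jk}S_{jk}$. With this convention, for the Schwarzschild metric above, $R_{1212}=-\frac{2m}{r^3}$ and $R_{3434}=2mr\sin^2\theta$. $\operatorname{div}R$ is the divergence of $R$, i.e. the contraction of $\nabla R$ over the derivative index and one index of $R$ (say $g^{pi}\nabla_pR_{ijkl}$). Kulkarni-Nomizu product of symmetric $(0,2)$-tensors $A,E$: $(A\wedge E)(X_1,X_2,X_3,X_4)=A(X_1,X_4)E(X_2,X_3)+A(X_2,X_3)E(X_1,X_4)-A(X_1,X_3)E(X_2,X_4)-A(X_2,X_4)E(X_1,X_3)$. For a symmetric $(0,2)$-tensor $E$: the endomorphism $\mathcal E$ is defined by $g(\mathcal EX_1,X_2)=E(X_1,X_2)$, and $(X\wedge_EY)X_1=E(Y,X_1)X-E(X,X_1)Y$. Denote by $\wedge_E$ also the $(0,4)$-tensor $(X_1,X_2,X_3,X_4)\mapsto g((X_1\wedge_EX_2)X_3,X_4)$. Curvature tensors: $\mathfrak G=\wedge_g$, $P=R-\frac1{n-1}\wedge_S$, $K=R-\frac1{n-2}(g\wedge S)$, $W=R-\frac{\kappa}{n(n-1)}\mathfrak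 G$, $C=K+\frac{\kappa}{(n-1)(n-2)}\mathfrak G$. For the $(0,4)$-tensor $R$: $$R\cdot R(X_1,X_2,X_3,X_4,X,Y)=-R(\mathcal R(X,Y)X_1,X_2,X_3,X_4)-\cdots-R(X_1,X_2,X_3,\mathcal R(X,Y)X_4),$$ $$Q(g,R)(X_1,\dots,X_4,X,Y)=g(X,X_1)R(Y,X_2,X_3,X_4)+\cdots+g(X,X_4)R(X_1,X_2,X_3,Y)$$ $$\qquad-g(Y,X_1)R(X,X_2,X_3,X_4)-\cdots-g(Y,X_4)R(X_1,X_2,X_3,X).$$ A metric is Deszcz pseudosymmetric if $R\cdot R=L\,Q(g,R)$ for some scalar $L$. Compatibility: a symmetric $(0,2)$-tensor $E$ (with endomorphism $\mathcal E$) is a compatible tensor for $R$ if $$R(\mathcal EX_1,X,X_2,X_3)+R(\mathcal EX_2,X,X_3,X_1)+R(\mathcal EX_3,X,X_1,X_2)=0$$ for all $X,X_1,X_2,X_3$. The matrix in (iv) is the matrix of components of such an $E$ in the coordinates $(u,r,\theta,\phi)$. *)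

theory Defs
  imports "HOL-Analysis.Analysis"
begin

text \<open>
  Semi-Riemannian geometry in a coordinate chart: the manifold is an open set \<open>U\<close> of
  \<open>real ^ 'n\<close>. Fields are total functions of which only the values on \<open>U\<close> matter.
  A \<open>(0,2)\<close>-tensor field, in particular a metric, is given by its matrix of components in the
  coordinate frame or by its action on vector fields; a \<open>(0,4)\<close>-tensor field by its action on
  vector fields.
\<close>

type_synonym 'n scalar_field = "real ^ 'n \<Rightarrow> real"
type_synonym 'n vector_field = "real ^ 'n \<Rightarrow> real ^ 'n"
type_synonym 'n matrix_field = "real ^ 'n \<Rightarrow> real ^ 'n ^ 'n"
type_synonym 'n tensor2 =
  "'n vector_field \<Rightarrow> 'n vector_field \<Rightarrow> 'n scalar_field"
type_synonym 'n tensor4 =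
  "'n vector_field \<Rightarrow> 'n vector_field \<Rightarrow> 'n vector_field \<Rightarrow> 'n vector_field \<Rightarrow> 'n scalar_field"

subsection \<open>Smooth fields\<close>

primrec times_differentiable_on ::
    "nat \<Rightarrow> 'a::real_normed_vector set \<Rightarrow> ('a \<Rightarrow> 'b::real_normed_vector) \<Rightarrow> bool" where
  "times_differentiable_on 0 U f \<longleftrightarrow> continuous_on U f"
| "times_differentiable_on (Suc k) U f \<longleftrightarrow>
     (\<forall>x\<in>U. f differentiable (at x)) \<and>
     (\<forall>v. times_differentiable_on k U (\<lambda>x. frechet_derivative f (at x) v))"

text \<open>On an open subset of a finite-dimensional space this is the class \<open>C\<^sup>\<infinity>\<close>.\<close>

definition smooth_on ::
    "'a::real_normed_vector set \<Rightarrow> ('a \<Rightarrow> 'b::real_normed_vector) \<Rightarrow> bool" where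
  "smooth_on U f \<longleftrightarrow> (\<forall>k. times_differentiable_on k U f)"

definition coord_field :: "'n \<Rightarrow> 'n::finite vector_field" where
  "coord_field i = (\<lambda>p. axis i 1)"

definition dir_deriv ::
    "'n::finite vector_field \<Rightarrow> 'n scalar_field \<Rightarrow> 'n scalar_field" where
  "dir_deriv X f p = frechet_derivative f (at p) (X p)"

definition lie_bracket ::
    "'n::finite vector_field \<Rightarrow> 'n vector_field \<Rightarrow> 'n vector_field" where
  "lie_bracket X Y p =
     frechet_derivative Y (at p) (X p) - frechet_derivative X (at p) (Y p)"

subsection \<open>Metric and Levi-Civita connection\<close>

definition bilin :: "real ^ 'n ^ 'n \<Rightarrow> real ^ 'n \<Rightarrow> real ^ 'n::finite \<Rightarrow> real" where
  "bilin M v w = (\<Sum>i\<in>UNIV. \<Sum>j\<in>UNIV. M $ i $ j * v $ i * w $ j)"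

definition form2 :: "'n::finite matrix_field \<Rightarrow> 'n tensor2" where
  "form2 A X Y p = bilin (A p) (X p) (Y p)"

abbreviation inv_metric :: "'n::finite matrix_field \<Rightarrow> 'n matrix_field" where
  "inv_metric g p \<equiv> matrix_inv (g p)"

text \<open>\<open>christoffel g p k i j\<close> is \<open>\<Gamma>\<^sup>k\<^sub>i\<^sub>j\<close> at \<open>p\<close>.\<close>

definition christoffel ::
    "'n::finite matrix_field \<Rightarrow> real ^ 'n \<Rightarrow> 'n \<Rightarrow> 'n \<Rightarrow> 'n \<Rightarrow> real" where
  "christoffel g p k i j =
     (1 / 2) * (\<Sum>l\<in>UNIV. inv_metric g p $ k $ l *
       (dir_deriv (coord_field i) (\<lambda>q. g q $ j $ l) p
      + dir_deriv (coord_field j) (\<lambda>q. g q $ i $ l) p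
      - dir_deriv (coord_field l) (\<lambda>q. g q $ i $ j) p))"

definition nabla ::
    "'n::finite matrix_field \<Rightarrow> 'n vector_field \<Rightarrow> 'n vector_field \<Rightarrow> 'n vector_field" where
  "nabla g X Y p = frechet_derivative Y (at p) (X p)
     + (\<chi> k. \<Sum>i\<in>UNIV. \<Sum>j\<in>UNIV. christoffel g p k i j * X p $ i * Y p $ j)"

text \<open>The two properties that characterize the Levi-Civita connection among the affine
  connections.\<close>

lemma nabla_torsion_free:
  fixes g :: "'n::finite matrix_field"
  assumes "open U" "p \<in> U" and sym: "\<And>q i j. q \<in> U \<Longrightarrow> g q $ i $ j = g q $ j $ i"
  shows "nabla g X Y p - nabla g Y X p = lie_bracket X Y p"
proof -
  have *: "dir_deriv Z (\<lambda>q. g q $ i $ j) p = dir_deriv Z (\<lambda>q. g q $ j $ i) p" for Z i j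
  proof -
    have imp: "((\<lambda>q. g q $ j $ i) has_derivative D) (at p)"
      if "((\<lambda>q. g q $ i $ j) has_derivative D) (at p)" for D i j
      by (rule has_derivative_transform_within_open[OF that assms(1,2)]) (rule sym)
    have "((\<lambda>q. g q $ i $ j) has_derivative D) (at p) \<longleftrightarrow>
          ((\<lambda>q. g q $ j $ i) has_derivative D) (at p)" for D
      using imp by blast
    then show ?thesis
      by (simp add: dir_deriv_def frechet_derivative_def)
  qed
  have "christoffel g p k i j = christoffel g p k j i" for k i j
    unfolding christoffel_def using *[of _ i j]
    by (simp only: add.commute)
  then have "(\<Sum>i\<in>UNIV. \<Sum>j\<in>UNIV. christoffel g p k i j * X p $ i * Y p $ j)
      = (\<Sum>i\<in>UNIV. \<Sum>j\<in>UNIV. christoffel g p k i j * Y p $ i * X p $ j)" for k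
    by (subst sum.swap) (intro sum.cong refl, simp)
  then show ?thesis
    by (simp add: nabla_def lie_bracket_def)
qed

lemma nabla_metric_compatible:
  fixes g :: "'n::finite matrix_field"
  assumes "open U" "p \<in> U" and sym: "\<And>q i j. q \<in> U \<Longrightarrow> g q $ i $ j = g q $ j $ i"
    and inv: "invertible (g p)"
    and dg: "g differentiable (at p)"
    and dY: "Y differentiable (at p)" and dZ: "Z differentiable (at p)"
  shows "dir_deriv X (form2 g Y Z) p = form2 g (nabla g X Y) Z p + form2 g Y (nabla g X Z) p"
proof -
  define G where "G = frechet_derivative g (at p)"
  define DY where "DY = frechet_derivative Y (at p)"
  define DZ where "DZ = frechet_derivative Z (at p)"
  have G: "(g has_derivative G) (at p)" and Y: "(Y has_derivative DY) (at p)"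
    and Z: "(Z has_derivative DZ) (at p)"
    using dg dY dZ by (simp_all add: G_def DY_def DZ_def frechet_derivative_works)
  have gij: "((\<lambda>q. g q $ i $ j) has_derivative (\<lambda>v. G v $ i $ j)) (at p)" for i j
    by (intro derivative_intros bounded_linear.has_derivative[OF bounded_linear_vec_nth] G)
  have Yi: "((\<lambda>q. Y q $ i) has_derivative (\<lambda>v. DY v $ i)) (at p)" for i
    by (intro bounded_linear.has_derivative[OF bounded_linear_vec_nth] Y)
  have Zi: "((\<lambda>q. Z q $ i) has_derivative (\<lambda>v. DZ v $ i)) (at p)" for i
    by (intro bounded_linear.has_derivative[OF bounded_linear_vec_nth] Z)
  have dd: "dir_deriv W (\<lambda>q. g q $ i $ j) p = G (W p) $ i $ j" for W i j
    by (simp add: dir_deriv_def frechet_derivative_at[OF gij[of i j], symmetric])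
  have Gsym: "G v $ i $ j = G v $ j $ i" for v i j
  proof -
    have "((\<lambda>q. g q $ j $ i) has_derivative (\<lambda>v. G v $ i $ j)) (at p)"
      by (rule has_derivative_transform_within_open[OF gij assms(1,2)]) (rule sym)
    from has_derivative_unique[OF this gij[of j i]] show ?thesis by (rule fun_cong)
  qed
  have linG: "linear G"
    using G has_derivative_linear by blast
  have Gsum: "G v = (\<Sum>i\<in>UNIV. v $ i *\<^sub>R G (axis i 1))" for v
  proof -
    have "G v = G (\<Sum>i\<in>UNIV. v $ i *\<^sub>R axis i 1)"
      using basis_expansion[of v] by (simp add: scalar_mult_eq_scaleR)
    then show ?thesis by (simp add: linear_sum[OF linG] linear_scale[OF linG])
  qed
  have gi: "(\<Sum>k\<in>UNIV. g p $ a $ k * matrix_inv (g p) $ k $ l) = (if a = l then 1 else 0)" for a l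
  proof -
    have "g p ** matrix_inv (g p) = mat 1"
      using inv unfolding invertible_def matrix_inv_def by (rule someI2_ex) simp
    then have "(g p ** matrix_inv (g p)) $ a $ l = mat 1 $ a $ l"
      by simp
    then show ?thesis by (simp add: matrix_matrix_mult_def mat_def)
  qed
  have lower: "(\<Sum>k\<in>UNIV. g p $ a $ k * christoffel g p k i j)
      = (1/2) * (G (axis i 1) $ j $ a + G (axis j 1) $ i $ a - G (axis a 1) $ i $ j)" for a i j
  proof -
    define t where "t l = G (axis i 1) $ j $ l + G (axis j 1) $ i $ l - G (axis l 1) $ i $ j" for l
    have "(\<Sum>k\<in>UNIV. g p $ a $ k * christoffel g p k i j)
        = (1/2) * (\<Sum>k\<in>UNIV. \<Sum>l\<in>UNIV. g p $ a $ k * matrix_inv (g p) $ k $ l * t l)"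
      by (simp add: christoffel_def dd coord_field_def t_def sum_distrib_left mult_ac)
    also have "(\<Sum>k\<in>UNIV. \<Sum>l\<in>UNIV. g p $ a $ k * matrix_inv (g p) $ k $ l * t l)
        = (\<Sum>l\<in>UNIV. (\<Sum>k\<in>UNIV. g p $ a $ k * matrix_inv (g p) $ k $ l) * t l)"
      by (subst sum.swap) (simp add: sum_distrib_right)
    also have "\<dots> = (\<Sum>l\<in>UNIV. if a = l then t l else 0)"
      unfolding gi by (intro sum.cong) auto
    also have "\<dots> = t a" by simp
    finally show ?thesis by (simp add: t_def)
  qed
  have Gam: "(\<Sum>i\<in>UNIV. \<Sum>j\<in>UNIV. g p $ i $ j * v $ i *
        (\<Sum>a\<in>UNIV. \<Sum>b\<in>UNIV. christoffel g p j a b * x $ a * w $ b))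
      = (\<Sum>a\<in>UNIV. \<Sum>i\<in>UNIV. \<Sum>b\<in>UNIV. (1/2) * (G (axis a 1) $ b $ i + G (axis b 1) $ a $ i
          - G (axis i 1) $ a $ b) * x $ a * v $ i * w $ b)" for v w x
  proof -
    have "(\<Sum>i\<in>UNIV. \<Sum>j\<in>UNIV. g p $ i $ j * v $ i *
        (\<Sum>a\<in>UNIV. \<Sum>b\<in>UNIV. christoffel g p j a b * x $ a * w $ b))
       = (\<Sum>i\<in>UNIV. \<Sum>j\<in>UNIV. \<Sum>a\<in>UNIV. \<Sum>b\<in>UNIV.
            g p $ i $ j * christoffel g p j a b * (x $ a * v $ i * w $ b))"
      by (simp add: sum_distrib_left mult_ac)
    also have "\<dots> = (\<Sum>i\<in>UNIV. \<Sum>a\<in>UNIV. \<Sum>b\<in>UNIV. \<Sum>j\<in>UNIV.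
            g p $ i $ j * christoffel g p j a b * (x $ a * v $ i * w $ b))"
      by (rule sum.cong[OF refl], subst sum.swap, rule sum.cong[OF refl], rule sum.swap)
    also have "\<dots> = (\<Sum>i\<in>UNIV. \<Sum>a\<in>UNIV. \<Sum>b\<in>UNIV.
            (\<Sum>j\<in>UNIV. g p $ i $ j * christoffel g p j a b) * (x $ a * v $ i * w $ b))"
      by (simp add: sum_distrib_right)
    finally show ?thesis
      unfolding lower by (subst (2) sum.swap) (simp add: mult.assoc)
  qed
  have "(form2 g Y Z has_derivative (\<lambda>v. \<Sum>i\<in>UNIV. \<Sum>j\<in>UNIV.
      G v $ i $ j * Y p $ i * Z p $ j + g p $ i $ j * DY v $ i * Z p $ j
      + g p $ i $ j * Y p $ i * DZ v $ j)) (at p)"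
    unfolding form2_def[abs_def] bilin_def
    by (rule derivative_eq_intros gij Yi Zi refl)+ (simp add: algebra_simps)
  from frechet_derivative_at[OF this]
  have L: "dir_deriv X (form2 g Y Z) p = (\<Sum>i\<in>UNIV. \<Sum>j\<in>UNIV.
      G (X p) $ i $ j * Y p $ i * Z p $ j + g p $ i $ j * DY (X p) $ i * Z p $ j
      + g p $ i $ j * Y p $ i * DZ (X p) $ j)"
    unfolding dir_deriv_def by (rule fun_cong[symmetric])
  have gsym: "g p $ i $ j = g p $ j $ i" for i j using sym assms(2) by blast
  have YZ: "form2 g Y (nabla g X Z) p = (\<Sum>i\<in>UNIV. \<Sum>j\<in>UNIV. g p $ i $ j * Y p $ i * DZ (X p) $ j)
      + (\<Sum>a\<in>UNIV. \<Sum>i\<in>UNIV. \<Sum>b\<in>UNIV. (1/2) * (G (axis a 1) $ b $ i + G (axis b 1) $ a $ i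
          - G (axis i 1) $ a $ b) * X p $ a * Y p $ i * Z p $ b)"
    unfolding Gam[symmetric]
    by (simp add: form2_def bilin_def nabla_def DZ_def distrib_left sum.distrib)
  have "form2 g (nabla g X Y) Z p = form2 g Z (nabla g X Y) p"
    unfolding form2_def bilin_def by (subst sum.swap) (simp add: gsym mult_ac)
  also have "\<dots> = (\<Sum>i\<in>UNIV. \<Sum>j\<in>UNIV. g p $ i $ j * Z p $ i * DY (X p) $ j)
      + (\<Sum>a\<in>UNIV. \<Sum>i\<in>UNIV. \<Sum>b\<in>UNIV. (1/2) * (G (axis a 1) $ b $ i + G (axis b 1) $ a $ i
          - G (axis i 1) $ a $ b) * X p $ a * Z p $ i * Y p $ b)"
    unfolding Gam[symmetric]
    by (simp add: form2_def bilin_def nabla_def DY_def distrib_left sum.distrib)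
  also have "(\<Sum>i\<in>UNIV. \<Sum>j\<in>UNIV. g p $ i $ j * Z p $ i * DY (X p) $ j)
      = (\<Sum>i\<in>UNIV. \<Sum>j\<in>UNIV. g p $ i $ j * DY (X p) $ i * Z p $ j)"
    by (subst sum.swap) (simp add: gsym mult_ac)
  also have "(\<Sum>a\<in>UNIV. \<Sum>i\<in>UNIV. \<Sum>b\<in>UNIV. (1/2) * (G (axis a 1) $ b $ i + G (axis b 1) $ a $ i
          - G (axis i 1) $ a $ b) * X p $ a * Z p $ i * Y p $ b)
      = (\<Sum>a\<in>UNIV. \<Sum>i\<in>UNIV. \<Sum>b\<in>UNIV. (1/2) * (G (axis a 1) $ i $ b + G (axis i 1) $ a $ b
          - G (axis b 1) $ a $ i) * X p $ a * Y p $ i * Z p $ b)"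
    by (rule sum.cong[OF refl], subst sum.swap) (simp add: mult_ac)
  finally have YZ': "form2 g (nabla g X Y) Z p
      = (\<Sum>i\<in>UNIV. \<Sum>j\<in>UNIV. g p $ i $ j * DY (X p) $ i * Z p $ j)
      + (\<Sum>a\<in>UNIV. \<Sum>i\<in>UNIV. \<Sum>b\<in>UNIV. (1/2) * (G (axis a 1) $ i $ b + G (axis i 1) $ a $ b
          - G (axis b 1) $ a $ i) * X p $ a * Y p $ i * Z p $ b)" .
  have "(\<Sum>i\<in>UNIV. \<Sum>j\<in>UNIV. G (X p) $ i $ j * Y p $ i * Z p $ j)
      = (\<Sum>i\<in>UNIV. \<Sum>b\<in>UNIV. \<Sum>a\<in>UNIV. G (axis a 1) $ i $ b * X p $ a * Y p $ i * Z p $ b)"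
    by (subst Gsum, simp add: sum_distrib_right, intro sum.cong refl, simp)
  also have "\<dots> = (\<Sum>i\<in>UNIV. \<Sum>a\<in>UNIV. \<Sum>b\<in>UNIV. G (axis a 1) $ i $ b * X p $ a * Y p $ i * Z p $ b)"
    by (rule sum.cong[OF refl], rule sum.swap)
  also have "\<dots> = (\<Sum>a\<in>UNIV. \<Sum>i\<in>UNIV. \<Sum>b\<in>UNIV. G (axis a 1) $ i $ b * X p $ a * Y p $ i * Z p $ b)"
    by (rule sum.swap)
  also have "\<dots> = (\<Sum>a\<in>UNIV. \<Sum>i\<in>UNIV. \<Sum>b\<in>UNIV. (1/2) * (G (axis a 1) $ i $ b + G (axis i 1) $ a $ b
          - G (axis b 1) $ a $ i) * X p $ a * Y p $ i * Z p $ b)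
      + (\<Sum>a\<in>UNIV. \<Sum>i\<in>UNIV. \<Sum>b\<in>UNIV. (1/2) * (G (axis a 1) $ b $ i + G (axis b 1) $ a $ i
          - G (axis i 1) $ a $ b) * X p $ a * Y p $ i * Z p $ b)"
    unfolding sum.distrib[symmetric]
  proof (intro sum.cong refl)
    fix a i b
    show "G (axis a 1) $ i $ b * X p $ a * Y p $ i * Z p $ b =
      (1/2) * (G (axis a 1) $ i $ b + G (axis i 1) $ a $ b
          - G (axis b 1) $ a $ i) * X p $ a * Y p $ i * Z p $ b +
      (1/2) * (G (axis a 1) $ b $ i + G (axis b 1) $ a $ i
          - G (axis i 1) $ a $ b) * X p $ a * Y p $ i * Z p $ b"
      using Gsym[of "axis a 1" b i] by (simp add: algebra_simps)
  qed
  finally show ?thesis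
    unfolding L YZ YZ' by (simp add: sum.distrib)
qed

subsection \<open>Curvature\<close>

definition curv_op ::
    "'n::finite matrix_field \<Rightarrow> 'n vector_field \<Rightarrow> 'n vector_field \<Rightarrow> 'n vector_field \<Rightarrow> 'n vector_field"
  where
  "curv_op g X Y Z p = nabla g (lie_bracket X Y) Z p
     - nabla g X (nabla g Y Z) p + nabla g Y (nabla g X Z) p"

definition riemann :: "'n::finite matrix_field \<Rightarrow> 'n tensor4" where
  "riemann g X1 X2 X3 X4 = form2 g (curv_op g X1 X2 X3) X4"

definition ricci :: "'n::finite matrix_field \<Rightarrow> 'n tensor2" where
  "ricci g Y Z p = (\<Sum>i\<in>UNIV. \<Sum>l\<in>UNIV.
     inv_metric g p $ i $ l * riemann g (coord_field i) Y Z (coord_field l) p)"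

definition scalar_curv :: "'n::finite matrix_field \<Rightarrow> 'n scalar_field" where
  "scalar_curv g p = (\<Sum>j\<in>UNIV. \<Sum>k\<in>UNIV.
     inv_metric g p $ j $ k * ricci g (coord_field j) (coord_field k) p)"

definition kulkarni_nomizu :: "'n::finite tensor2 \<Rightarrow> 'n tensor2 \<Rightarrow> 'n tensor4" where
  "kulkarni_nomizu A E X1 X2 X3 X4 p =
     A X1 X4 p * E X2 X3 p + A X2 X3 p * E X1 X4 p
   - A X1 X3 p * E X2 X4 p - A X2 X4 p * E X1 X3 p"

definition wedge_op ::
    "'n::finite tensor2 \<Rightarrow> 'n vector_field \<Rightarrow> 'n vector_field \<Rightarrow> 'n vector_field \<Rightarrow> 'n vector_field"
  where
  "wedge_op E X Y X1 p = E Y X1 p *\<^sub>R X p - E X X1 p *\<^sub>R Y p"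

definition wedge4 :: "'n::finite matrix_field \<Rightarrow> 'n tensor2 \<Rightarrow> 'n tensor4" where
  "wedge4 g E X1 X2 X3 X4 = form2 g (wedge_op E X1 X2 X3) X4"

definition gauss_tensor :: "'n::finite matrix_field \<Rightarrow> 'n tensor4" where
  "gauss_tensor g = wedge4 g (form2 g)"

definition projective :: "'n::finite matrix_field \<Rightarrow> 'n tensor4" where
  "projective g X1 X2 X3 X4 p = riemann g X1 X2 X3 X4 p
     - 1 / (real CARD('n) - 1) * wedge4 g (ricci g) X1 X2 X3 X4 p"

definition conharmonic :: "'n::finite matrix_field \<Rightarrow> 'n tensor4" where
  "conharmonic g X1 X2 X3 X4 p = riemann g X1 X2 X3 X4 p
     - 1 / (real CARD('n) - 2) * kulkarni_nomizu (form2 g) (ricci g) X1 X2 X3 X4 p"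

definition concircular :: "'n::finite matrix_field \<Rightarrow> 'n tensor4" where
  "concircular g X1 X2 X3 X4 p = riemann g X1 X2 X3 X4 p
     - scalar_curv g p / (real CARD('n) * (real CARD('n) - 1)) * gauss_tensor g X1 X2 X3 X4 p"

definition conformal :: "'n::finite matrix_field \<Rightarrow> 'n tensor4" where
  "conformal g X1 X2 X3 X4 p = conharmonic g X1 X2 X3 X4 p
     + scalar_curv g p / ((real CARD('n) - 1) * (real CARD('n) - 2)) * gauss_tensor g X1 X2 X3 X4 p"

definition tensor4_eq_on :: "(real ^ 'n) set \<Rightarrow> 'n::finite tensor4 \<Rightarrow> 'n tensor4 \<Rightarrow> bool" where
  "tensor4_eq_on U T T' \<longleftrightarrow>
     (\<forall>X1 X2 X3 X4. smooth_on U X1 \<and> smooth_on U X2 \<and> smooth_on U X3 \<and> smooth_on U X4 \<longrightarrow>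
        (\<forall>p\<in>U. T X1 X2 X3 X4 p = T' X1 X2 X3 X4 p))"

definition ricci_flat :: "(real ^ 'n) set \<Rightarrow> 'n::finite matrix_field \<Rightarrow> bool" where
  "ricci_flat U g \<longleftrightarrow>
     (\<forall>Y Z. smooth_on U Y \<and> smooth_on U Z \<longrightarrow> (\<forall>p\<in>U. ricci g Y Z p = 0))"

subsection \<open>Divergence of the curvature tensor\<close>

definition nabla4 ::
    "'n::finite matrix_field \<Rightarrow> 'n tensor4 \<Rightarrow> 'n vector_field \<Rightarrow> 'n tensor4" where
  "nabla4 g T X X1 X2 X3 X4 p = dir_deriv X (T X1 X2 X3 X4) p
     - T (nabla g X X1) X2 X3 X4 p - T X1 (nabla g X X2) X3 X4 p
     - T X1 X2 (nabla g X X3) X4 p - T X1 X2 X3 (nabla g X X4) p"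

definition div_riemann ::
    "'n::finite matrix_field \<Rightarrow> 'n vector_field \<Rightarrow> 'n vector_field \<Rightarrow> 'n vector_field \<Rightarrow> 'n scalar_field"
  where
  "div_riemann g X2 X3 X4 p = (\<Sum>q\<in>UNIV. \<Sum>i\<in>UNIV. inv_metric g p $ q $ i *
     nabla4 g (riemann g) (coord_field q) (coord_field i) X2 X3 X4 p)"

definition harmonic_curv :: "(real ^ 'n) set \<Rightarrow> 'n::finite matrix_field \<Rightarrow> bool" where
  "harmonic_curv U g \<longleftrightarrow>
     (\<forall>X2 X3 X4. smooth_on U X2 \<and> smooth_on U X3 \<and> smooth_on U X4 \<longrightarrow>
        (\<forall>p\<in>U. div_riemann g X2 X3 X4 p = 0))"

subsection \<open>Pseudosymmetry\<close>

text \<open>\<open>curv_act g T\<close> is \<open>R \<cdot> T\<close> and \<open>tachibana g T\<close> is \<open>Q(g, T)\<close>; the last two arguments are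
  the additional vector fields \<open>X\<close>, \<open>Y\<close>.\<close>

definition curv_act ::
    "'n::finite matrix_field \<Rightarrow> 'n tensor4 \<Rightarrow> 'n vector_field \<Rightarrow> 'n vector_field \<Rightarrow>
     'n vector_field \<Rightarrow> 'n vector_field \<Rightarrow> 'n tensor2" where
  "curv_act g T X1 X2 X3 X4 X Y p =
     - T (curv_op g X Y X1) X2 X3 X4 p - T X1 (curv_op g X Y X2) X3 X4 p
     - T X1 X2 (curv_op g X Y X3) X4 p - T X1 X2 X3 (curv_op g X Y X4) p"

definition tachibana ::
    "'n::finite matrix_field \<Rightarrow> 'n tensor4 \<Rightarrow> 'n vector_field \<Rightarrow> 'n vector_field \<Rightarrow>
     'n vector_field \<Rightarrow> 'n vector_field \<Rightarrow> 'n tensor2" where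
  "tachibana g T X1 X2 X3 X4 X Y p =
     form2 g X X1 p * T Y X2 X3 X4 p + form2 g X X2 p * T X1 Y X3 X4 p
   + form2 g X X3 p * T X1 X2 Y X4 p + form2 g X X4 p * T X1 X2 X3 Y p
   - form2 g Y X1 p * T X X2 X3 X4 p - form2 g Y X2 p * T X1 X X3 X4 p
   - form2 g Y X3 p * T X1 X2 X X4 p - form2 g Y X4 p * T X1 X2 X3 X p"

definition pseudosymmetric_with ::
    "(real ^ 'n) set \<Rightarrow> 'n::finite matrix_field \<Rightarrow> 'n scalar_field \<Rightarrow> bool" where
  "pseudosymmetric_with U g L \<longleftrightarrow>
     (\<forall>X1 X2 X3 X4 X Y.
        smooth_on U X1 \<and> smooth_on U X2 \<and> smooth_on U X3 \<and> smooth_on U X4 \<and>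
        smooth_on U X \<and> smooth_on U Y \<longrightarrow>
        (\<forall>p\<in>U. curv_act g (riemann g) X1 X2 X3 X4 X Y p
                = L p * tachibana g (riemann g) X1 X2 X3 X4 X Y p))"

definition deszcz_pseudosymmetric :: "(real ^ 'n) set \<Rightarrow> 'n::finite matrix_field \<Rightarrow> bool" where
  "deszcz_pseudosymmetric U g \<longleftrightarrow> (\<exists>L. smooth_on U L \<and> pseudosymmetric_with U g L)"

subsection \<open>Compatible tensors\<close>

definition symmetric_tensor2_on :: "(real ^ 'n) set \<Rightarrow> 'n::finite matrix_field \<Rightarrow> bool" where
  "symmetric_tensor2_on U E \<longleftrightarrow> smooth_on U E \<and> (\<forall>p\<in>U. transpose (E p) = E p)"

text \<open>The vector is unique where \<open>g\<close> is nondegenerate.\<close>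

definition endo ::
    "'n::finite matrix_field \<Rightarrow> 'n matrix_field \<Rightarrow> 'n vector_field \<Rightarrow> 'n vector_field" where
  "endo g E X p = (THE v. \<forall>w. bilin (g p) v w = bilin (E p) (X p) w)"

definition compatible_tensor ::
    "(real ^ 'n) set \<Rightarrow> 'n::finite matrix_field \<Rightarrow> 'n matrix_field \<Rightarrow> bool" where
  "compatible_tensor U g E \<longleftrightarrow>
     symmetric_tensor2_on U E \<and>
     (\<forall>X X1 X2 X3. smooth_on U X \<and> smooth_on U X1 \<and> smooth_on U X2 \<and> smooth_on U X3 \<longrightarrow>
        (\<forall>p\<in>U. riemann g (endo g E X1) X X2 X3 p + riemann g (endo g E X2) X X3 X1 p
              + riemann g (endo g E X3) X X1 X2 p = 0))"

subsection \<open>The Schwarzschild metric\<close>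

text \<open>Coordinates \<open>(u, r, \<theta>, \<phi>) = (x $ 1, x $ 2, x $ 3, x $ 4)\<close>. The term \<open>-2 dr du\<close> is a
  symmetric product and contributes \<open>-1\<close> to each of the two mixed components. The axis
  \<open>sin \<theta> = 0\<close>, where the metric degenerates, is not covered by the coordinates.\<close>

definition schwarzschild :: "real \<Rightarrow> 4 matrix_field" where
  "schwarzschild m x =
     vector [vector [- (1 - 2 * m / x $ 2), -1, 0, 0],
             vector [-1, 0, 0, 0],
             vector [0, 0, (x $ 2)\<^sup>2, 0],
             vector [0, 0, 0, (x $ 2)\<^sup>2 * (sin (x $ 3))\<^sup>2]]"

definition schwarzschild_domain :: "(real ^ 4) set" where
  "schwarzschild_domain = {x. x $ 2 > 0 \<and> sin (x $ 3) \<noteq> 0}"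

end

theory Submission
  imports Defs
begin

text \<open>
  The tangent spaces split into the \<open>(u, r)\<close>-plane and the \<open>(\<theta>, \<phi>)\<close>-plane; let \<open>h\<close> and \<open>k\<close>
  be the parts of \<open>g\<close> on the two planes. Then \<open>R = (m / r\<^sup>3) (h \<and> k - h \<and> h - k \<and> k)\<close>,
  and \<open>\<nabla>\<^sub>x h (y, z) = - \<nabla>\<^sub>x k (y, z) = (k(x, z) dr(y) + k(x, y) dr(z)) / r\<close>. Ricci flatness, the
  vanishing divergence and pseudosymmetry are algebraic consequences of these two formulas. For a
  symmetric \<open>E\<close> without components mixing the planes, both \<open>h(\<E>x, y)\<close> and \<open>k(\<E>x, y)\<close> are
  symmetric and the cyclic sum cancels in pairs; conversely, coordinate fields from both planes
  isolate each mixed component of \<open>E\<close> with the factor \<open>3m / r\<^sup>3\<close>.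
\<close>

section \<open>Smooth functions on open sets\<close>

text \<open>The notions act on vector fields, and \<open>curv_op\<close> differentiates them twice.
  So a formula for \<open>R\<close> in the values of \<open>h\<close> and \<open>k\<close> at a
  point first needs that \<open>curv_op\<close> depends only on the values of its arguments there.
  This is what the analysis is for: smoothness is developed far enough that \<open>nabla\<close>
  stays within smooth fields, and symmetry of second derivatives cancels those of the third
  argument. As \<open>U\<close> is open, the resulting formulas may be differentiated again. What
  remains are identities in values at a single point. The factor 3 in the mixed components, and
  again in the derivative of the curvature, combines the coefficient 1 of products across the planes
  with the coefficient -2 of products within one plane.\<close>

lemma frechet_derivative_cong_open:
  assumes "open U" "x \<in> U" "\<And>y. y \<in> U \<Longrightarrow> f y = g y"
  shows "frechet_derivative f (at x) = frechet_derivative g (at x)"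
proof -
  \<comment> \<open>\<open>frechet_derivative\<close> chooses from the set of derivatives; both
    functions have the same set, even where it is empty, so the choices agree.\<close>
  have "(f has_derivative D) (at x) \<longleftrightarrow> (g has_derivative D) (at x)" for D
    using assms by (metis has_derivative_transform_within_open)
  then show ?thesis by (simp add: frechet_derivative_def)
qed

lemma has_derivative_frechet:
  "(f has_derivative D) (at x) \<Longrightarrow> frechet_derivative f (at x) = D"
  using frechet_derivative_at by metis

lemma times_differentiable_on_cong:
  assumes "open U" "\<And>x. x \<in> U \<Longrightarrow> f x = g x"
  shows "times_differentiable_on k U f \<longleftrightarrow> times_differentiable_on k U g"
  using assms(2)
proof (induction k arbitrary: f g)
  case 0
  then show ?case by (simp cong: continuous_on_cong)
next
  case (Suc k)
  have "frechet_derivative f (at x) = frechet_derivative g (at x)" if "x \<in> U" for x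
    using frechet_derivative_cong_open[OF assms(1) that Suc.prems] .
  then have "times_differentiable_on k U (\<lambda>x. frechet_derivative f (at x) v) \<longleftrightarrow>
      times_differentiable_on k U (\<lambda>x. frechet_derivative g (at x) v)" for v
    by (intro Suc.IH) simp
  moreover have "f differentiable (at x) \<longleftrightarrow> g differentiable (at x)" if "x \<in> U" for x
    using Suc.prems that assms(1) unfolding differentiable_def
    by (metis has_derivative_transform_within_open)
  ultimately show ?case by simp
qed

lemma smooth_on_cong:
  assumes "open U" "\<And>x. x \<in> U \<Longrightarrow> f x = g x"
  shows "smooth_on U f \<longleftrightarrow> smooth_on U g"
  unfolding smooth_on_def using times_differentiable_on_cong[OF assms] by simp

lemma smooth_on_differentiable: "smooth_on U f \<Longrightarrow> x \<in> U \<Longrightarrow> f differentiable (at x)"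
  unfolding smooth_on_def by (metis times_differentiable_on.simps(2))

lemma smooth_on_has_derivative:
  "smooth_on U f \<Longrightarrow> x \<in> U \<Longrightarrow> (f has_derivative frechet_derivative f (at x)) (at x)"
  using smooth_on_differentiable frechet_derivative_works by blast

lemma smooth_on_continuous: "smooth_on U f \<Longrightarrow> continuous_on U f"
  unfolding smooth_on_def by (metis times_differentiable_on.simps(1))

lemma smooth_on_frechet: "smooth_on U f \<Longrightarrow> smooth_on U (\<lambda>x. frechet_derivative f (at x) v)"
  unfolding smooth_on_def by (metis times_differentiable_on.simps(2))

lemma times_differentiable_onI:
  assumes "open U" "\<And>x. x \<in> U \<Longrightarrow> (f has_derivative f' x) (at x)"
    and "\<And>v. times_differentiable_on k U (\<lambda>x. f' x v)"
  shows "times_differentiable_on (Suc k) U f"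
proof -
  have "times_differentiable_on k U (\<lambda>x. frechet_derivative f (at x) v)" for v
    using assms(3)[of v]
    by (subst times_differentiable_on_cong[OF assms(1)]) (auto simp: has_derivative_frechet[OF assms(2)])
  then show ?thesis using assms(2) by (auto simp: differentiable_def)
qed

lemma times_differentiable_on_add:
  assumes "open U" "times_differentiable_on k U f" "times_differentiable_on k U g"
  shows "times_differentiable_on k U (\<lambda>x. f x + g x)"
  using assms(2,3)
proof (induction k arbitrary: f g)
  case (Suc k)
  then show ?case
    by (intro times_differentiable_onI[OF assms(1), where f' = "\<lambda>x v.
        frechet_derivative f (at x) v + frechet_derivative g (at x) v"] derivative_intros)
      (auto simp: frechet_derivative_works)
qed (auto intro: continuous_intros)

text \<open>Coinduction up to sums.\<close>

lemma smooth_on_coinduct: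
  assumes "open U" "P f"
    and "\<And>f. P f \<Longrightarrow> \<exists>a b. (\<forall>x\<in>U. (f has_derivative (\<lambda>v. a v x + b v x)) (at x)) \<and>
           (\<forall>v. P (a v)) \<and> (\<forall>v. P (b v))"
  shows "smooth_on U f"
  unfolding smooth_on_def
proof
  fix k
  show "times_differentiable_on k U f" using assms(2)
  proof (induction k arbitrary: f)
    case 0
    then show ?case
      using assms(3)[OF 0] has_derivative_continuous
      by (force intro!: continuous_at_imp_continuous_on)
  next
    case (Suc k)
    from assms(3)[OF Suc.prems] obtain a b
      where "\<forall>x\<in>U. (f has_derivative (\<lambda>v. a v x + b v x)) (at x)"
        and "\<forall>v. P (a v)" "\<forall>v. P (b v)"
      by blast
    then show ?case
      by (intro times_differentiable_onI[OF assms(1), where f' = "\<lambda>x v. a v x + b v x"]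
          times_differentiable_on_add assms(1) Suc.IH) auto
  qed
qed

lemma smooth_on_const: "smooth_on U (\<lambda>x. c)"
proof -
  have "times_differentiable_on k U (\<lambda>x. c)" for k
    by (induction k arbitrary: c) auto
  then show ?thesis by (simp add: smooth_on_def)
qed

lemma smooth_on_add:
  "open U \<Longrightarrow> smooth_on U f \<Longrightarrow> smooth_on U g \<Longrightarrow> smooth_on U (\<lambda>x. f x + g x)"
  unfolding smooth_on_def using times_differentiable_on_add by blast

lemma smooth_on_sum:
  "open U \<Longrightarrow> (\<And>i. i \<in> I \<Longrightarrow> smooth_on U (f i)) \<Longrightarrow> smooth_on U (\<lambda>x. \<Sum>i\<in>I. f i x)"
  by (induction I rule: infinite_finite_induct) (auto intro: smooth_on_add smooth_on_const)

lemma smooth_on_bounded_linear: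
  fixes f :: "'a::real_normed_vector \<Rightarrow> 'b::real_normed_vector"
  assumes "open U" "bounded_linear L" "smooth_on U f"
  shows "smooth_on U (\<lambda>x. L (f x))"
proof -
  interpret bounded_linear L by fact
  let ?P = "\<lambda>h. \<exists>f :: 'a \<Rightarrow> 'b. smooth_on U f \<and> h = (\<lambda>x. L (f x))"
  have L: "?P (\<lambda>x. L (f x))" if "smooth_on U f" for f :: "'a \<Rightarrow> 'b"
    using that by blast
  show ?thesis
  proof (rule smooth_on_coinduct[where P = ?P])
    fix h assume "?P h"
    then obtain f where f: "smooth_on U f" and h: "h = (\<lambda>x. L (f x))" by blast
    \<comment> \<open>One summand carries the derivative; the other is \<open>L 0\<close>, which is
      zero and still \<open>L\<close> of a smooth function.\<close>
    show "\<exists>a b. (\<forall>x\<in>U. (h has_derivative (\<lambda>v. a v x + b v x)) (at x)) \<and>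
        (\<forall>v. ?P (a v)) \<and> (\<forall>v. ?P (b v))"
    proof (rule exI[of _ "\<lambda>v x. L (frechet_derivative f (at x) v)"],
        rule exI[of _ "\<lambda>v x. L 0"], intro conjI ballI allI)
      show "(h has_derivative (\<lambda>v. L (frechet_derivative f (at x) v) + L 0)) (at x)" if "x \<in> U" for x
        unfolding h zero add_0_right
        by (intro has_derivative smooth_on_has_derivative[OF f that])
    qed (intro L smooth_on_frechet f smooth_on_const)+
  qed (use assms L in blast)+
qed

text \<open>Products are closed under differentiation only up to sums: the product rule yields two
  of them, one for each summand of \<open>smooth_on_coinduct\<close>.\<close>

lemma smooth_on_mult:
  fixes f g :: "'a::real_normed_vector \<Rightarrow> real"
  assumes "open U" "smooth_on U f" "smooth_on U g"
  shows "smooth_on U (\<lambda>x. f x * g x)"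
proof -
  let ?P = "\<lambda>h. \<exists>f g :: 'a \<Rightarrow> real. smooth_on U f \<and> smooth_on U g \<and> h = (\<lambda>x. f x * g x)"
  have M: "?P (\<lambda>x. f x * g x)" if "smooth_on U f" "smooth_on U g" for f g :: "'a \<Rightarrow> real"
    using that by blast
  show ?thesis
  proof (rule smooth_on_coinduct[where P = ?P])
    fix h assume "?P h"
    then obtain f g where f: "smooth_on U f" and g: "smooth_on U g" and h: "h = (\<lambda>x. f x * g x)"
      by blast
    show "\<exists>a b. (\<forall>x\<in>U. (h has_derivative (\<lambda>v. a v x + b v x)) (at x)) \<and>
        (\<forall>v. ?P (a v)) \<and> (\<forall>v. ?P (b v))"
    proof (rule exI[of _ "\<lambda>v x. f x * frechet_derivative g (at x) v"],
        rule exI[of _ "\<lambda>v x. frechet_derivative f (at x) v * g x"], intro conjI ballI allI)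
      show "(h has_derivative (\<lambda>v. f x * frechet_derivative g (at x) v +
          frechet_derivative f (at x) v * g x)) (at x)" if "x \<in> U" for x
        unfolding h by (rule has_derivative_mult[OF smooth_on_has_derivative[OF f that]
              smooth_on_has_derivative[OF g that]])
    qed (intro M smooth_on_frechet f g)+
  qed (use assms M in blast)+
qed

lemma smooth_on_minus:
  "open U \<Longrightarrow> smooth_on U f \<Longrightarrow> smooth_on U (\<lambda>x. - f x)"
  by (rule smooth_on_bounded_linear[OF _ bounded_linear_minus[OF bounded_linear_ident]])

lemma smooth_on_diff:
  "open U \<Longrightarrow> smooth_on U f \<Longrightarrow> smooth_on U g \<Longrightarrow> smooth_on U (\<lambda>x. f x - g x)"
  using smooth_on_add[of U f "\<lambda>x. - g x"] smooth_on_minus[of U g] by simp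

lemma smooth_on_power:
  fixes f :: "'a::real_normed_vector \<Rightarrow> real"
  shows "open U \<Longrightarrow> smooth_on U f \<Longrightarrow> smooth_on U (\<lambda>x. f x ^ n)"
  by (induction n) (auto intro: smooth_on_mult smooth_on_const)

text \<open>The functions \<open>a x * inverse (f x) ^ n\<close> with smooth \<open>a\<close> are
  closed under differentiation up to sums: one summand differentiates \<open>a\<close>, the other
  raises the exponent by one.\<close>

lemma smooth_on_inverse:
  fixes f :: "'a::real_normed_vector \<Rightarrow> real"
  assumes "open U" "smooth_on U f" and nz: "\<And>x. x \<in> U \<Longrightarrow> f x \<noteq> 0"
  shows "smooth_on U (\<lambda>x. inverse (f x))"
proof -
  let ?D = "frechet_derivative"
  let ?P = "\<lambda>h. \<exists>a n. smooth_on U a \<and> h = (\<lambda>x. a x * inverse (f x) ^ n)"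
  have I: "?P (\<lambda>x. a x * inverse (f x) ^ n)" if "smooth_on U a" for a n
    using that by blast
  show ?thesis
  proof (rule smooth_on_coinduct[where P = ?P])
    fix h assume "?P h"
    then obtain a n where a: "smooth_on U a" and h: "h = (\<lambda>x. a x * inverse (f x) ^ n)" by blast
    show "\<exists>a b. (\<forall>x\<in>U. (h has_derivative (\<lambda>v. a v x + b v x)) (at x)) \<and>
        (\<forall>v. ?P (a v)) \<and> (\<forall>v. ?P (b v))"
    proof (rule exI[of _ "\<lambda>v x. ?D a (at x) v * inverse (f x) ^ n"],
        rule exI[of _ "\<lambda>v x. - (real n * (a x * ?D f (at x) v)) * inverse (f x) ^ (n + 1)"], intro conjI ballI allI)
      show "(h has_derivative (\<lambda>v. ?D a (at x) v * inverse (f x) ^ n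
          + - (real n * (a x * ?D f (at x) v)) * inverse (f x) ^ (n + 1))) (at x)" if "x \<in> U" for x
      proof -
        note i = Deriv.has_derivative_inverse[OF nz[OF that] smooth_on_has_derivative[OF assms(2) that]]
        \<comment> \<open>The rule for powers produces the exponent \<open>n - 1\<close>, which
          truncates at \<open>n = 0\<close>; hence the case distinction.\<close>
        show ?thesis unfolding h
          by (rule has_derivative_eq_rhs[OF has_derivative_mult[OF
                smooth_on_has_derivative[OF a that] has_derivative_power[OF i]]])
            (cases n, auto simp: fun_eq_iff algebra_simps)
      qed
    qed (intro I smooth_on_minus smooth_on_mult smooth_on_const a smooth_on_frechet assms)+
  next
    show "?P (\<lambda>x. inverse (f x))"
      using I[of "\<lambda>x. 1" 1] by (simp add: smooth_on_const)
  qed fact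
qed

lemma smooth_on_divide:
  fixes f g :: "'a::real_normed_vector \<Rightarrow> real"
  assumes "open U" "smooth_on U f" "smooth_on U g" "\<And>x. x \<in> U \<Longrightarrow> g x \<noteq> 0"
  shows "smooth_on U (\<lambda>x. f x / g x)"
  unfolding divide_inverse by (intro smooth_on_mult smooth_on_inverse assms)

text \<open>Combinations of \<open>sin (f x)\<close> and \<open>cos (f x)\<close> with smooth
  coefficients reproduce themselves under differentiation; the coefficients take up the derivative
  of \<open>f\<close>.\<close>

lemma smooth_on_sin:
  fixes f :: "'a::real_normed_vector \<Rightarrow> real"
  assumes "open U" "smooth_on U f"
  shows "smooth_on U (\<lambda>x. sin (f x))"
proof -
  let ?D = "frechet_derivative"
  let ?P = "\<lambda>h. \<exists>a b. smooth_on U a \<and> smooth_on U b \<and> h = (\<lambda>x. a x * sin (f x) + b x * cos (f x))"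
  have P: "?P (\<lambda>x. a x * sin (f x) + b x * cos (f x))" if "smooth_on U a" "smooth_on U b" for a b
    using that by blast
  show ?thesis
  proof (rule smooth_on_coinduct[where P = ?P])
    fix h assume "?P h"
    then obtain a b where a: "smooth_on U a" and b: "smooth_on U b"
      and h: "h = (\<lambda>x. a x * sin (f x) + b x * cos (f x))" by blast
    show "\<exists>a b. (\<forall>x\<in>U. (h has_derivative (\<lambda>v. a v x + b v x)) (at x)) \<and>
        (\<forall>v. ?P (a v)) \<and> (\<forall>v. ?P (b v))"
    proof (rule exI[of _ "\<lambda>v x. ?D a (at x) v * sin (f x) + ?D b (at x) v * cos (f x)"],
        rule exI[of _ "\<lambda>v x. - (b x * ?D f (at x) v) * sin (f x) + (a x * ?D f (at x) v) * cos (f x)"], intro conjI ballI allI)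
      show "(h has_derivative (\<lambda>v. ?D a (at x) v * sin (f x) + ?D b (at x) v * cos (f x) +
          (- (b x * ?D f (at x) v) * sin (f x) + (a x * ?D f (at x) v) * cos (f x)))) (at x)"
        if "x \<in> U" for x
        unfolding h
        by (rule derivative_eq_intros smooth_on_has_derivative[OF a that]
            smooth_on_has_derivative[OF b that] smooth_on_has_derivative[OF assms(2) that] refl)+
          (auto simp: algebra_simps)
    qed (intro P smooth_on_minus smooth_on_mult a b smooth_on_frechet assms)+
  next
    show "?P (\<lambda>x. sin (f x))"
      using P[of "\<lambda>x. 1" "\<lambda>x. 0"] by (simp add: smooth_on_const)
  qed fact
qed

lemma smooth_on_nth:
  fixes f :: "'a::real_normed_vector \<Rightarrow> 'b::real_normed_vector ^ 'n"
  shows "open U \<Longrightarrow> smooth_on U f \<Longrightarrow> smooth_on U (\<lambda>x. f x $ i)"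
  by (rule smooth_on_bounded_linear[OF _ bounded_linear_vec_nth])

lemma bounded_linear_axis: "bounded_linear (axis i :: 'b::real_normed_vector \<Rightarrow> 'b ^ 'n::finite)"
proof (rule bounded_linear_intro[where K = 1])
  fix x :: 'b
  have "norm (axis i x :: 'b ^ 'n) \<le> (\<Sum>j\<in>UNIV. norm ((axis i x :: 'b ^ 'n) $ j))"
    by (simp add: norm_vec_def L2_set_le_sum)
  also have "\<dots> = (\<Sum>j\<in>UNIV. if j = i then norm x else 0)"
    by (intro sum.cong) (auto simp: axis_def)
  finally show "norm (axis i x :: 'b ^ 'n) \<le> norm x * 1" by simp
qed (auto simp: axis_def vec_eq_iff)

lemma vec_eq_sum_axis: "x = (\<Sum>i\<in>UNIV. axis i (x $ i))"
  for x :: "'b::comm_monoid_add ^ 'n::finite"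
  by (simp add: vec_eq_iff axis_def)

lemma has_derivative_vec:
  fixes f :: "'a::real_normed_vector \<Rightarrow> 'b::real_normed_vector ^ 'n::finite"
  assumes "\<And>i. ((\<lambda>x. f x $ i) has_derivative (\<lambda>v. f' v $ i)) F"
  shows "(f has_derivative f') F"
proof -
  have "((\<lambda>x. \<Sum>i\<in>UNIV. axis i (f x $ i)) has_derivative (\<lambda>v. \<Sum>i\<in>UNIV. axis i (f' v $ i))) F"
    by (intro has_derivative_sum bounded_linear.has_derivative[OF bounded_linear_axis] assms)
  then show ?thesis by (simp only: vec_eq_sum_axis[symmetric])
qed

lemma smooth_on_vec:
  fixes f :: "'a::real_normed_vector \<Rightarrow> 'b::real_normed_vector ^ 'n::finite"
  assumes "open U" "\<And>i. smooth_on U (\<lambda>x. f x $ i)"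
  shows "smooth_on U f"
proof -
  have "smooth_on U (\<lambda>x. \<Sum>i\<in>UNIV. axis i (f x $ i))"
    by (intro smooth_on_sum smooth_on_bounded_linear[OF _ bounded_linear_axis] assms)
  then show ?thesis by (simp only: vec_eq_sum_axis[symmetric])
qed

lemma smooth_on_coord:
  fixes U :: "(real ^ 'n::finite) set"
  assumes "open U"
  shows "smooth_on U (\<lambda>x. x $ i)"
proof -
  have "times_differentiable_on k U (\<lambda>x. x $ i)" for k
  proof (cases k)
    case (Suc n)
    show ?thesis unfolding Suc
    proof (rule times_differentiable_onI[OF assms])
      show "((\<lambda>x. x $ i) has_derivative (\<lambda>v. v $ i)) (at x)" for x :: "real ^ 'n"
        by (intro bounded_linear_imp_has_derivative bounded_linear_vec_nth)
      show "times_differentiable_on n U (\<lambda>x. v $ i)" for v :: "real ^ 'n"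
        using smooth_on_const unfolding smooth_on_def by blast
    qed
  qed (auto intro: continuous_intros)
  then show ?thesis by (simp add: smooth_on_def)
qed

section \<open>Symmetry of second derivatives\<close>

text \<open>The second difference over the parallelogram with sides \<open>t u\<close> and
  \<open>t v\<close> is symmetric in \<open>u\<close> and \<open>v\<close>, while the mean value
  theorem, applied along \<open>u\<close> and then along \<open>v\<close>, turns it into a second
  derivative in a fixed order at some point of the parallelogram.\<close>

lemma second_difference_mvt:
  fixes f :: "'a::real_normed_vector \<Rightarrow> real"
  assumes f: "smooth_on U f" and t: "t > 0"
    and U: "\<And>a b. 0 \<le> a \<Longrightarrow> a \<le> t \<Longrightarrow> 0 \<le> b \<Longrightarrow> b \<le> t \<Longrightarrow> p + a *\<^sub>R u + b *\<^sub>R v \<in> U"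
  shows "\<exists>a b. 0 \<le> a \<and> a \<le> t \<and> 0 \<le> b \<and> b \<le> t \<and>
    f (p + t *\<^sub>R u + t *\<^sub>R v) - f (p + t *\<^sub>R u) - f (p + t *\<^sub>R v) + f p
    = t * t * frechet_derivative (\<lambda>x. frechet_derivative f (at x) u) (at (p + a *\<^sub>R u + b *\<^sub>R v)) v"
proof -
  let ?D = "\<lambda>f x. frechet_derivative f (at x)"
  have chain: "((\<lambda>s. h (q + s *\<^sub>R w)) has_derivative (\<lambda>d. d * ?D h (q + s *\<^sub>R w) w)) (at s within S)"
    if "smooth_on U h" "q + s *\<^sub>R w \<in> U" for h :: "'a \<Rightarrow> real" and q w s S
  proof -
    note h = smooth_on_has_derivative[OF that]
    have "((\<lambda>s. q + s *\<^sub>R w) has_derivative (\<lambda>d. d *\<^sub>R w)) (at s within S)"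
      by (auto intro!: derivative_eq_intros)
    from has_derivative_compose[OF this h] show ?thesis
      by (simp add: linear_scale[OF has_derivative_linear[OF h]])
  qed
  have chain1: "((\<lambda>s. h (p + s *\<^sub>R u + b *\<^sub>R v)) has_derivative (\<lambda>d. d * ?D h (p + s *\<^sub>R u + b *\<^sub>R v) u)) (at s within S)"
    if "smooth_on U h" "0 \<le> s" "s \<le> t" "0 \<le> b" "b \<le> t" for h :: "'a \<Rightarrow> real" and s b S
    using chain[OF that(1), of "p + b *\<^sub>R v" s u] U[OF that(2-5)] by (simp add: add_ac)
  have chain2: "((\<lambda>s. h (p + a *\<^sub>R u + s *\<^sub>R v)) has_derivative (\<lambda>d. d * ?D h (p + a *\<^sub>R u + s *\<^sub>R v) v)) (at s within S)"
    if "smooth_on U h" "0 \<le> s" "s \<le> t" "0 \<le> a" "a \<le> t" for h :: "'a \<Rightarrow> real" and s a S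
    by (rule chain[OF that(1) U[OF that(4,5,2,3)]])
  \<comment> \<open>The term \<open>0 *\<^sub>R v\<close> stays unsimplified so that both terms are
    instances of \<open>chain1\<close>, with \<open>b = t\<close> and \<open>b = 0\<close>.\<close>
  let ?\<phi> = "\<lambda>s. f (p + s *\<^sub>R u + t *\<^sub>R v) - f (p + s *\<^sub>R u + 0 *\<^sub>R v)"
  have "\<exists>a\<in>{0<..<t}. ?\<phi> t - ?\<phi> 0 = (t - 0) * ?D f (p + a *\<^sub>R u + t *\<^sub>R v) u - (t - 0) * ?D f (p + a *\<^sub>R u + 0 *\<^sub>R v) u"
    using t by (intro mvt_simple) (auto intro!: has_derivative_diff chain1[OF f] simp del: scaleR_zero_left)
  then obtain a where a: "0 \<le> a" "a \<le> t"
    and "?\<phi> t - ?\<phi> 0 = (t - 0) * ?D f (p + a *\<^sub>R u + t *\<^sub>R v) u - (t - 0) * ?D f (p + a *\<^sub>R u + 0 *\<^sub>R v) u"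
    using less_imp_le by (metis greaterThanLessThan_iff)
  then have 1: "?\<phi> t - ?\<phi> 0 = t * (?D f (p + a *\<^sub>R u + t *\<^sub>R v) u - ?D f (p + a *\<^sub>R u + 0 *\<^sub>R v) u)"
    by (simp add: right_diff_distrib)
  let ?g = "\<lambda>x. ?D f x u"
  have "\<exists>b\<in>{0<..<t}. ?g (p + a *\<^sub>R u + t *\<^sub>R v) - ?g (p + a *\<^sub>R u + 0 *\<^sub>R v) = (t - 0) * ?D ?g (p + a *\<^sub>R u + b *\<^sub>R v) v"
    using t a by (intro mvt_simple) (auto intro!: chain2 smooth_on_frechet f)
  then obtain b where b: "0 \<le> b" "b \<le> t"
    and 2: "?g (p + a *\<^sub>R u + t *\<^sub>R v) - ?g (p + a *\<^sub>R u + 0 *\<^sub>R v) = t * ?D ?g (p + a *\<^sub>R u + b *\<^sub>R v) v"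
    using less_imp_le by (metis diff_zero greaterThanLessThan_iff)
  show ?thesis
    using a b 1 unfolding 2 by (intro exI[of _ a] exI[of _ b]) simp
qed

text \<open>Dividing the same second difference by \<open>t * t\<close> makes the two orders of
  differentiation agree at two nearby, generally different points; continuity carries the equality
  to \<open>p\<close>.\<close>

lemma second_derivative_symmetric_real:
  fixes f :: "'a::real_normed_vector \<Rightarrow> real"
  assumes "open U" "p \<in> U" and f: "smooth_on U f"
  shows "frechet_derivative (\<lambda>x. frechet_derivative f (at x) u) (at p) v
       = frechet_derivative (\<lambda>x. frechet_derivative f (at x) v) (at p) u"
proof -
  let ?D = "\<lambda>f x. frechet_derivative f (at x)"
  define A where "A x = ?D (\<lambda>x. ?D f x u) x v" for x
  define B where "B x = ?D (\<lambda>x. ?D f x v) x u" for x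
  have "isCont A p" "isCont B p"
    unfolding A_def B_def
    using assms by (auto intro!: smooth_on_frechet continuous_on_interior[OF smooth_on_continuous] simp: interior_open)
  have "dist (A p) (B p) \<le> 0 + e" if "e > 0" for e
  proof -
    have "\<forall>\<^sub>F x in nhds p. x \<in> U" using assms by (simp add: eventually_nhds_in_open)
    moreover have "\<forall>\<^sub>F x in nhds p. dist (A x) (A p) < e / 2"
      using \<open>isCont A p\<close> that by (intro tendstoD) (simp_all add: isCont_def tendsto_at_iff_tendsto_nhds)
    moreover have "\<forall>\<^sub>F x in nhds p. dist (B x) (B p) < e / 2"
      using \<open>isCont B p\<close> that by (intro tendstoD) (simp_all add: isCont_def tendsto_at_iff_tendsto_nhds)
    ultimately have "\<forall>\<^sub>F x in nhds p. x \<in> U \<and> dist (A x) (A p) < e / 2 \<and> dist (B x) (B p) < e / 2"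
      by eventually_elim simp
    then obtain d where d: "d > 0"
      and *: "\<And>x. dist x p < d \<Longrightarrow> x \<in> U \<and> dist (A x) (A p) < e / 2 \<and> dist (B x) (B p) < e / 2"
      unfolding eventually_nhds_metric by blast
    \<comment> \<open>This side length keeps the parallelogram inside the ball of radius
      \<open>d\<close>; the summand 1 keeps the denominator positive when \<open>u\<close> and
      \<open>v\<close> vanish.\<close>
    define t where "t = d / (norm u + norm v + 1)"
    have pos: "norm u + norm v + 1 > 0" by (simp add: add_nonneg_pos)
    then have t: "t > 0" using d by (simp add: t_def)
    have near: "dist (p + a *\<^sub>R u + b *\<^sub>R v) p < d" if "0 \<le> a" "a \<le> t" "0 \<le> b" "b \<le> t" for a b
    proof -
      have "dist (p + a *\<^sub>R u + b *\<^sub>R v) p \<le> a * norm u + b * norm v"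
        using norm_triangle_ineq[of "a *\<^sub>R u" "b *\<^sub>R v"] that by (simp add: dist_norm add.assoc)
      also have "\<dots> \<le> t * norm u + t * norm v" using that by (intro add_mono mult_right_mono) auto
      also have "\<dots> < t * (norm u + norm v + 1)" using t by (simp add: algebra_simps)
      also have "\<dots> = d" using pos by (simp add: t_def)
      finally show ?thesis .
    qed
    have near': "dist (p + a *\<^sub>R v + b *\<^sub>R u) p < d" if "0 \<le> a" "a \<le> t" "0 \<le> b" "b \<le> t" for a b
      using near[OF that(3,4,1,2)] by (simp add: add_ac)
    obtain a b where ab: "0 \<le> a" "a \<le> t" "0 \<le> b" "b \<le> t"
      "f (p + t *\<^sub>R u + t *\<^sub>R v) - f (p + t *\<^sub>R u) - f (p + t *\<^sub>R v) + f p = t * t * A (p + a *\<^sub>R u + b *\<^sub>R v)"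
      unfolding A_def using second_difference_mvt[OF f t, of p u v] near * by blast
    obtain a' b' where ab': "0 \<le> a'" "a' \<le> t" "0 \<le> b'" "b' \<le> t"
      "f (p + t *\<^sub>R v + t *\<^sub>R u) - f (p + t *\<^sub>R v) - f (p + t *\<^sub>R u) + f p = t * t * B (p + a' *\<^sub>R v + b' *\<^sub>R u)"
      unfolding B_def using second_difference_mvt[OF f t, of p v u] near' * by blast
    have "t * t * A (p + a *\<^sub>R u + b *\<^sub>R v) = t * t * B (p + a' *\<^sub>R v + b' *\<^sub>R u)"
      unfolding ab(5)[symmetric] ab'(5)[symmetric] by (simp add: add_ac)
    then have "A (p + a *\<^sub>R u + b *\<^sub>R v) = B (p + a' *\<^sub>R v + b' *\<^sub>R u)" using t by simp
    moreover have "dist (A (p + a *\<^sub>R u + b *\<^sub>R v)) (A p) < e / 2"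
      using *[OF near[OF ab(1-4)]] by blast
    moreover have "dist (B (p + a' *\<^sub>R v + b' *\<^sub>R u)) (B p) < e / 2"
      using *[OF near'[OF ab'(1-4)]] by blast
    ultimately show ?thesis
      unfolding dist_real_def by linarith
  qed
  then have "dist (A p) (B p) \<le> 0" by (rule field_le_epsilon)
  then show ?thesis by (simp add: A_def B_def)
qed

lemma frechet_derivative_nth:
  "f differentiable (at x) \<Longrightarrow> frechet_derivative (\<lambda>x. f x $ i) (at x) v = frechet_derivative f (at x) v $ i"
  using has_derivative_frechet[OF bounded_linear.has_derivative[OF bounded_linear_vec_nth]]
  by (metis frechet_derivative_works)

lemma second_derivative_symmetric:
  fixes f :: "'a::real_normed_vector \<Rightarrow> real ^ 'n::finite"
  assumes "open U" "p \<in> U" and f: "smooth_on U f"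
  shows "frechet_derivative (\<lambda>x. frechet_derivative f (at x) u) (at p) v
       = frechet_derivative (\<lambda>x. frechet_derivative f (at x) v) (at p) u"
proof -
  have "frechet_derivative (\<lambda>x. frechet_derivative f (at x) u) (at p) v $ i
      = frechet_derivative (\<lambda>x. frechet_derivative (\<lambda>x. f x $ i) (at x) u) (at p) v" for u v i
  proof -
    have "frechet_derivative (\<lambda>x. frechet_derivative (\<lambda>x. f x $ i) (at x) u) (at p)
        = frechet_derivative (\<lambda>x. frechet_derivative f (at x) u $ i) (at p)"
      by (rule frechet_derivative_cong_open[OF assms(1,2)])
        (simp add: frechet_derivative_nth smooth_on_differentiable[OF f])
    then show ?thesis
      by (simp add: frechet_derivative_nth smooth_on_differentiable[OF smooth_on_frechet[OF f] assms(2)])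
  qed
  then show ?thesis
    by (simp add: vec_eq_iff second_derivative_symmetric_real[OF assms(1,2) smooth_on_nth[OF assms(1) f]])
qed

section \<open>The curvature operator in coordinates\<close>

lemma linear_axis_expansion:
  assumes "linear L"
  shows "L v = (\<Sum>i\<in>UNIV. v $ i *\<^sub>R L (axis i 1))"
proof -
  have "L v = L (\<Sum>i\<in>UNIV. v $ i *\<^sub>R axis i 1)"
    using basis_expansion[of v] by (simp add: scalar_mult_eq_scaleR)
  then show ?thesis by (simp add: linear_sum[OF assms] linear_scale[OF assms])
qed

text \<open>Product rule for a linear map that varies with the point. Differentiability is given for
  each fixed vector; the standard basis replaces the moving vector by finitely many fixed ones with
  scalar coefficients.\<close>

lemma has_derivative_linear_apply:
  fixes L :: "'a::real_normed_vector \<Rightarrow> real ^ 'n::finite \<Rightarrow> 'b::real_normed_vector"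
  assumes U: "open U" "p \<in> U" and lin: "\<And>q. q \<in> U \<Longrightarrow> linear (L q)"
    and L: "\<And>v. ((\<lambda>q. L q v) has_derivative L' v) (at p)"
    and Y: "(Y has_derivative Y') (at p)"
  shows "((\<lambda>q. L q (Y q)) has_derivative (\<lambda>x. L' (Y p) x + L p (Y' x))) (at p)"
proof -
  have Yi: "((\<lambda>q. Y q $ i) has_derivative (\<lambda>x. Y' x $ i)) (at p)" for i
    by (rule bounded_linear.has_derivative[OF bounded_linear_vec_nth Y])
  have L'': "((\<lambda>q. L q v) has_derivative (\<lambda>x. \<Sum>i\<in>UNIV. v $ i *\<^sub>R L' (axis i 1) x)) (at p)" for v
  proof (rule has_derivative_transform_within_open[OF _ U])
    show "((\<lambda>q. \<Sum>i\<in>UNIV. v $ i *\<^sub>R L q (axis i 1)) has_derivative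
        (\<lambda>x. \<Sum>i\<in>UNIV. v $ i *\<^sub>R L' (axis i 1) x)) (at p)"
      by (intro has_derivative_sum has_derivative_scaleR_right L)
    show "(\<Sum>i\<in>UNIV. v $ i *\<^sub>R L q (axis i 1)) = L q v" if "q \<in> U" for q
      using linear_axis_expansion[OF lin[OF that], of v] by simp
  qed
  \<comment> \<open>Linearity of \<open>L'\<close> in \<open>v\<close> is inherited from
    \<open>L q\<close> because derivatives are unique.\<close>
  have L': "L' v x = (\<Sum>i\<in>UNIV. v $ i *\<^sub>R L' (axis i 1) x)" for v x
    using fun_cong[OF has_derivative_unique[OF L[of v] L''[of v]], of x] .
  have "((\<lambda>q. \<Sum>i\<in>UNIV. Y q $ i *\<^sub>R L q (axis i 1)) has_derivative
      (\<lambda>x. \<Sum>i\<in>UNIV. Y p $ i *\<^sub>R L' (axis i 1) x + Y' x $ i *\<^sub>R L p (axis i 1))) (at p)"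
    by (intro has_derivative_sum has_derivative_scaleR Yi L)
  moreover have "(\<Sum>i\<in>UNIV. Y p $ i *\<^sub>R L' (axis i 1) x + Y' x $ i *\<^sub>R L p (axis i 1)) =
      L' (Y p) x + L p (Y' x)" for x
    by (simp add: sum.distrib L'[of "Y p"] linear_axis_expansion[OF lin[OF U(2)], of "Y' x"])
  ultimately have "((\<lambda>q. \<Sum>i\<in>UNIV. Y q $ i *\<^sub>R L q (axis i 1)) has_derivative
      (\<lambda>x. L' (Y p) x + L p (Y' x))) (at p)" by simp
  then show ?thesis
  proof (rule has_derivative_transform_within_open[OF _ U])
    show "(\<Sum>i\<in>UNIV. Y q $ i *\<^sub>R L q (axis i 1)) = L q (Y q)" if "q \<in> U" for q
      using linear_axis_expansion[OF lin[OF that], of "Y q"] by simp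
  qed
qed

lemma smooth_on_frechet_apply:
  fixes X :: "real ^ 'n::finite \<Rightarrow> real ^ 'n" and Y :: "real ^ 'n \<Rightarrow> real ^ 'm::finite"
  assumes "open U" "smooth_on U X" "smooth_on U Y"
  shows "smooth_on U (\<lambda>p. frechet_derivative Y (at p) (X p))"
proof (rule smooth_on_vec[OF assms(1)])
  fix i
  have "smooth_on U (\<lambda>p. \<Sum>j\<in>UNIV. X p $ j * frechet_derivative Y (at p) (axis j 1) $ i)"
    by (intro smooth_on_sum smooth_on_mult smooth_on_nth smooth_on_frechet assms)
  moreover have "frechet_derivative Y (at p) (X p) $ i
      = (\<Sum>j\<in>UNIV. X p $ j * frechet_derivative Y (at p) (axis j 1) $ i)" if "p \<in> U" for p
    using linear_axis_expansion[OF has_derivative_linear[OF smooth_on_has_derivative[OF assms(3) that]], of "X p"]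
    by simp
  ultimately show "smooth_on U (\<lambda>p. frechet_derivative Y (at p) (X p) $ i)"
    by (subst smooth_on_cong[OF assms(1)])
qed

definition christoffel_form ::
    "'n::finite matrix_field \<Rightarrow> real ^ 'n \<Rightarrow> real ^ 'n \<Rightarrow> real ^ 'n \<Rightarrow> real ^ 'n" where
  "christoffel_form g p v w = (\<chi> k. \<Sum>i\<in>UNIV. \<Sum>j\<in>UNIV. christoffel g p k i j * v $ i * w $ j)"

lemma nabla_christoffel_form:
  "nabla g X Y p = frechet_derivative Y (at p) (X p) + christoffel_form g p (X p) (Y p)"
  by (simp add: nabla_def christoffel_form_def)

lemma linear_christoffel_form_left: "linear (\<lambda>v. christoffel_form g p v w)"
  by (rule linearI) (simp_all add: christoffel_form_def vec_eq_iff algebra_simps sum.distrib sum_distrib_left)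

lemma linear_christoffel_form_right: "linear (\<lambda>w. christoffel_form g p v w)"
  by (rule linearI) (simp_all add: christoffel_form_def vec_eq_iff algebra_simps sum.distrib sum_distrib_left)

lemma smooth_on_christoffel:
  assumes "open U" "smooth_on U g" "\<And>i j. smooth_on U (\<lambda>p. inv_metric g p $ i $ j)"
  shows "smooth_on U (\<lambda>p. christoffel g p k i j)"
  unfolding christoffel_def dir_deriv_def coord_field_def
  by (intro smooth_on_mult smooth_on_sum smooth_on_add smooth_on_diff smooth_on_const
      smooth_on_frechet smooth_on_nth assms)

locale smooth_christoffel =
  fixes U :: "(real ^ 'n::finite) set" and g :: "'n matrix_field"
  assumes open_U: "open U"
    and smooth_christoffel: "\<And>k i j. smooth_on U (\<lambda>p. christoffel g p k i j)"
begin

lemma smooth_on_christoffel_form: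
  "smooth_on U X \<Longrightarrow> smooth_on U Y \<Longrightarrow> smooth_on U (\<lambda>p. christoffel_form g p (X p) (Y p))"
  by (rule smooth_on_vec[OF open_U], simp add: christoffel_form_def)
    (intro smooth_on_sum smooth_on_mult smooth_on_nth smooth_christoffel open_U)

lemma smooth_on_nabla: "smooth_on U X \<Longrightarrow> smooth_on U Y \<Longrightarrow> smooth_on U (nabla g X Y)"
  unfolding nabla_christoffel_form[abs_def]
  by (intro smooth_on_add smooth_on_frechet_apply smooth_on_christoffel_form open_U)

lemma smooth_on_lie_bracket: "smooth_on U X \<Longrightarrow> smooth_on U Y \<Longrightarrow> smooth_on U (lie_bracket X Y)"
  unfolding lie_bracket_def[abs_def] by (intro smooth_on_diff smooth_on_frechet_apply open_U)

lemma smooth_on_curv_op: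
  "smooth_on U X \<Longrightarrow> smooth_on U Y \<Longrightarrow> smooth_on U Z \<Longrightarrow> smooth_on U (curv_op g X Y Z)"
  unfolding curv_op_def[abs_def]
  by (intro smooth_on_add smooth_on_diff smooth_on_nabla smooth_on_lie_bracket open_U)

lemma has_derivative_christoffel_form:
  "p \<in> U \<Longrightarrow> ((\<lambda>q. christoffel_form g q v w) has_derivative
     frechet_derivative (\<lambda>q. christoffel_form g q v w) (at p)) (at p)"
  by (rule smooth_on_has_derivative[where U = U])
    (intro smooth_on_christoffel_form[of "\<lambda>_. v" "\<lambda>_. w"] smooth_on_const)

lemma has_derivative_nabla:
  assumes p: "p \<in> U" and Y: "smooth_on U Y" and Z: "smooth_on U Z"
  defines "DY \<equiv> frechet_derivative Y (at p)" and "DZ \<equiv> frechet_derivative Z (at p)"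
  shows "(nabla g Y Z has_derivative (\<lambda>x.
      frechet_derivative (\<lambda>q. frechet_derivative Z (at q) (Y p)) (at p) x + DZ (DY x)
      + (frechet_derivative (\<lambda>q. christoffel_form g q (Y p) (Z p)) (at p) x
         + christoffel_form g p (DY x) (Z p) + christoffel_form g p (Y p) (DZ x)))) (at p)"
  unfolding nabla_christoffel_form[abs_def]
proof (rule has_derivative_add)
  note Y' = smooth_on_has_derivative[OF Y p, folded DY_def]
  note Z' = smooth_on_has_derivative[OF Z p, folded DZ_def]
  show "((\<lambda>q. frechet_derivative Z (at q) (Y q)) has_derivative (\<lambda>x.
      frechet_derivative (\<lambda>q. frechet_derivative Z (at q) (Y p)) (at p) x + DZ (DY x))) (at p)"
    unfolding DZ_def
    by (rule has_derivative_linear_apply[OF open_U p _ _ Y'])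
      (auto intro: has_derivative_linear smooth_on_has_derivative Z smooth_on_frechet p)
  \<comment> \<open>The bilinear form is handled one argument at a time: its derivative for every
    fixed second argument is the input of the same rule applied to the second argument.\<close>
  have "((\<lambda>q. christoffel_form g q (Y q) w) has_derivative (\<lambda>x.
      frechet_derivative (\<lambda>q. christoffel_form g q (Y p) w) (at p) x
      + christoffel_form g p (DY x) w)) (at p)" for w
    by (rule has_derivative_linear_apply[OF open_U p linear_christoffel_form_left
          has_derivative_christoffel_form[OF p] Y'])
  then show "((\<lambda>q. christoffel_form g q (Y q) (Z q)) has_derivative (\<lambda>x.
      frechet_derivative (\<lambda>q. christoffel_form g q (Y p) (Z p)) (at p) x
         + christoffel_form g p (DY x) (Z p) + christoffel_form g p (Y p) (DZ x))) (at p)"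
    by (rule has_derivative_linear_apply[OF open_U p linear_christoffel_form_right _ Z'])
qed

text \<open>The derivatives of \<open>X\<close>, \<open>Y\<close>, \<open>Z\<close> cancel: the second derivatives of \<open>Z\<close> by their symmetry,
  those of \<open>X\<close> and \<open>Y\<close> against the Lie bracket.\<close>

lemma curv_op_coordinates:
  assumes p: "p \<in> U" and X: "smooth_on U X" and Y: "smooth_on U Y" and Z: "smooth_on U Z"
  shows "curv_op g X Y Z p =
     frechet_derivative (\<lambda>q. christoffel_form g q (X p) (Z p)) (at p) (Y p)
   - frechet_derivative (\<lambda>q. christoffel_form g q (Y p) (Z p)) (at p) (X p)
   + christoffel_form g p (Y p) (christoffel_form g p (X p) (Z p))
   - christoffel_form g p (X p) (christoffel_form g p (Y p) (Z p))"
proof -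
  note [simp] = linear_diff[OF has_derivative_linear[OF smooth_on_has_derivative[OF Z p]]]
    linear_diff[OF linear_christoffel_form_left] linear_add[OF linear_christoffel_form_right]
  show ?thesis
    using second_derivative_symmetric[OF open_U p Z, of "X p" "Y p"]
    by (simp add: curv_op_def nabla_christoffel_form[of g X "nabla g Y Z"]
        nabla_christoffel_form[of g Y "nabla g X Z"] nabla_christoffel_form[of g _ Z]
        has_derivative_frechet[OF has_derivative_nabla[OF p Y Z]]
        has_derivative_frechet[OF has_derivative_nabla[OF p X Z]] lie_bracket_def)
qed

end

section \<open>The Schwarzschild metric\<close>

lemma vector_4 [simp]:
  "(vector [a, b, c, d] :: 'a::zero ^ 4) $ 1 = a" "(vector [a, b, c, d] :: 'a ^ 4) $ 2 = b"
  "(vector [a, b, c, d] :: 'a ^ 4) $ 3 = c" "(vector [a, b, c, d] :: 'a ^ 4) $ 4 = d"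
  unfolding vector_def by simp_all

definition schwarzschild_inv :: "real \<Rightarrow> 4 matrix_field" where
  "schwarzschild_inv m p =
     vector [vector [0, -1, 0, 0],
             vector [-1, 1 - 2 * m / p $ 2, 0, 0],
             vector [0, 0, inverse ((p $ 2)\<^sup>2), 0],
             vector [0, 0, 0, inverse ((p $ 2)\<^sup>2 * (sin (p $ 3))\<^sup>2)]]"

lemma schwarzschild_times_inv:
  assumes "p \<in> schwarzschild_domain"
  shows "schwarzschild m p ** schwarzschild_inv m p = mat 1"
  using assms
  by (simp add: schwarzschild_def schwarzschild_inv_def matrix_matrix_mult_def mat_def vec_eq_iff
      forall_4 sum_4 schwarzschild_domain_def)
    (simp add: field_simps)

lemma inv_metric_schwarzschild:
  assumes "p \<in> schwarzschild_domain"
  shows "inv_metric (schwarzschild m) p = schwarzschild_inv m p"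
proof -
  let ?A = "schwarzschild m p" and ?B = "schwarzschild_inv m p"
  note AB = schwarzschild_times_inv[OF assms, of m]
  have BA: "?B ** ?A = mat 1" using AB by (simp add: matrix_left_right_inverse)
  have "?A ** matrix_inv ?A = mat 1"
    unfolding matrix_inv_def by (rule someI2[of _ ?B]) (simp_all add: AB BA)
  then have "?B ** ?A ** matrix_inv ?A = ?B" by (simp flip: matrix_mul_assoc)
  then show ?thesis by (simp add: BA)
qed

lemma smooth_on_schwarzschild:
  assumes "open U" "U \<subseteq> schwarzschild_domain"
  shows "smooth_on U (schwarzschild m)"
proof -
  have [simp]: "x $ 2 \<noteq> 0" if "x \<in> U" for x
    using assms(2) that by (auto simp: schwarzschild_domain_def)
  have "\<forall>i j. smooth_on U (\<lambda>x. schwarzschild m x $ i $ j)"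
    unfolding schwarzschild_def forall_4 vector_4
    by (intro conjI smooth_on_minus smooth_on_diff smooth_on_divide smooth_on_mult smooth_on_power
        smooth_on_const smooth_on_coord smooth_on_sin assms(1)) simp_all
  then show ?thesis by (intro smooth_on_vec assms(1)) blast
qed

lemma smooth_on_inv_schwarzschild:
  assumes "open U" "U \<subseteq> schwarzschild_domain"
  shows "smooth_on U (\<lambda>p. inv_metric (schwarzschild m) p $ i $ j)"
proof -
  have [simp]: "x $ 2 \<noteq> 0" "sin (x $ 3) \<noteq> 0" if "x \<in> U" for x
    using assms(2) that by (auto simp: schwarzschild_domain_def)
  have "\<forall>i j. smooth_on U (\<lambda>x. schwarzschild_inv m x $ i $ j)"
    unfolding schwarzschild_inv_def forall_4 vector_4
    by (intro conjI smooth_on_diff smooth_on_divide smooth_on_mult smooth_on_power smooth_on_inverse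
        smooth_on_const smooth_on_coord smooth_on_sin assms(1)) simp_all
  moreover have "inv_metric (schwarzschild m) p = schwarzschild_inv m p" if "p \<in> U" for p
    using inv_metric_schwarzschild that assms(2) by blast
  ultimately show ?thesis by (subst smooth_on_cong[OF assms(1)]) auto
qed

definition schwarzschild_deriv :: "real \<Rightarrow> real ^ 4 \<Rightarrow> real ^ 4 \<Rightarrow> real ^ 4 ^ 4" where
  "schwarzschild_deriv m p v =
     vector [vector [- (2 * m * v $ 2 / (p $ 2)\<^sup>2), 0, 0, 0],
             vector [0, 0, 0, 0],
             vector [0, 0, 2 * p $ 2 * v $ 2, 0],
             vector [0, 0, 0, 2 * p $ 2 * v $ 2 * (sin (p $ 3))\<^sup>2
                              + 2 * (p $ 2)\<^sup>2 * sin (p $ 3) * cos (p $ 3) * v $ 3]]"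

lemma has_derivative_nth: "((\<lambda>x. x $ i) has_derivative (\<lambda>v. v $ i)) F"
  for i :: "'n::finite"
  by (intro bounded_linear_imp_has_derivative bounded_linear_vec_nth)

lemma dir_deriv_schwarzschild:
  assumes "p \<in> schwarzschild_domain"
  shows "dir_deriv X (\<lambda>q. schwarzschild m q $ i $ j) p = schwarzschild_deriv m p (X p) $ i $ j"
proof -
  have p: "p $ 2 \<noteq> 0" using assms by (auto simp: schwarzschild_domain_def)
  have "\<forall>i j. ((\<lambda>q. schwarzschild m q $ i $ j) has_derivative
      (\<lambda>v. schwarzschild_deriv m p v $ i $ j)) (at p)"
    unfolding schwarzschild_def schwarzschild_deriv_def forall_4 vector_4
    using p
    by (auto intro!: derivative_eq_intros has_derivative_nth simp: field_simps power2_eq_square)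
  then have "((\<lambda>q. schwarzschild m q $ i $ j) has_derivative
      (\<lambda>v. schwarzschild_deriv m p v $ i $ j)) (at p)" by blast
  from has_derivative_frechet[OF this] show ?thesis
    by (simp add: dir_deriv_def)
qed

definition schwarzschild_christoffel :: "real \<Rightarrow> real ^ 4 \<Rightarrow> real ^ 4 \<Rightarrow> real ^ 4 \<Rightarrow> real ^ 4" where
  "schwarzschild_christoffel m p v w =
     vector [- (m / (p $ 2)\<^sup>2) * (v $ 1 * w $ 1) + p $ 2 * (v $ 3 * w $ 3) + p $ 2 * (sin (p $ 3))\<^sup>2 * (v $ 4 * w $ 4),
             m / (p $ 2)\<^sup>2 * (v $ 1 * w $ 2 + v $ 2 * w $ 1) + (1 - 2 * m / p $ 2) * m / (p $ 2)\<^sup>2 * (v $ 1 * w $ 1)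
               - (p $ 2 - 2 * m) * (v $ 3 * w $ 3) - (p $ 2 - 2 * m) * (sin (p $ 3))\<^sup>2 * (v $ 4 * w $ 4),
             inverse (p $ 2) * (v $ 2 * w $ 3 + v $ 3 * w $ 2) - sin (p $ 3) * cos (p $ 3) * (v $ 4 * w $ 4),
             inverse (p $ 2) * (v $ 2 * w $ 4 + v $ 4 * w $ 2)
               + cos (p $ 3) / sin (p $ 3) * (v $ 3 * w $ 4 + v $ 4 * w $ 3)]"

lemma christoffel_form_schwarzschild:
  assumes "p \<in> schwarzschild_domain"
  shows "christoffel_form (schwarzschild m) p v w = schwarzschild_christoffel m p v w"
proof -
  have p: "p $ 2 \<noteq> 0" "sin (p $ 3) \<noteq> 0" using assms by (auto simp: schwarzschild_domain_def)
  have *: "christoffel (schwarzschild m) p k i j = (1 / 2) * (\<Sum>l\<in>UNIV. schwarzschild_inv m p $ k $ l *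
       (schwarzschild_deriv m p (axis i 1) $ j $ l + schwarzschild_deriv m p (axis j 1) $ i $ l
        - schwarzschild_deriv m p (axis l 1) $ i $ j))" for k i j
    by (simp add: christoffel_def dir_deriv_schwarzschild[OF assms]
        inv_metric_schwarzschild[OF assms] coord_field_def)
  show ?thesis
    unfolding christoffel_form_def vec_eq_iff vec_lambda_beta *
    using p
    by (simp add: forall_4 sum_4 schwarzschild_inv_def schwarzschild_deriv_def axis_def
        schwarzschild_christoffel_def)
      (simp add: field_simps power2_eq_square)
qed

text \<open>\<open>x\<close> is the direction of differentiation. Only \<open>x $ 2\<close> and
  \<open>x $ 3\<close> occur, as the metric does not depend on \<open>u\<close> and
  \<open>\<phi>\<close>.\<close>

definition schwarzschild_christoffel_deriv ::
    "real \<Rightarrow> real ^ 4 \<Rightarrow> real ^ 4 \<Rightarrow> real ^ 4 \<Rightarrow> real ^ 4 \<Rightarrow> real ^ 4" where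
  "schwarzschild_christoffel_deriv m p v w x =
     vector [x $ 2 * (2 * m / p $ 2 ^ 3 * (v $ 1 * w $ 1) + v $ 3 * w $ 3 + (sin (p $ 3))\<^sup>2 * (v $ 4 * w $ 4))
               + x $ 3 * (2 * p $ 2 * sin (p $ 3) * cos (p $ 3) * (v $ 4 * w $ 4)),
             x $ 2 * (- (2 * m / p $ 2 ^ 3) * (v $ 1 * w $ 2 + v $ 2 * w $ 1)
                 + (6 * m\<^sup>2 / p $ 2 ^ 4 - 2 * m / p $ 2 ^ 3) * (v $ 1 * w $ 1)
                 - v $ 3 * w $ 3 - (sin (p $ 3))\<^sup>2 * (v $ 4 * w $ 4))
               - x $ 3 * ((p $ 2 - 2 * m) * 2 * sin (p $ 3) * cos (p $ 3) * (v $ 4 * w $ 4)),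
             - (x $ 2 / (p $ 2)\<^sup>2) * (v $ 2 * w $ 3 + v $ 3 * w $ 2)
               - x $ 3 * ((cos (p $ 3))\<^sup>2 - (sin (p $ 3))\<^sup>2) * (v $ 4 * w $ 4),
             - (x $ 2 / (p $ 2)\<^sup>2) * (v $ 2 * w $ 4 + v $ 4 * w $ 2)
               - x $ 3 / (sin (p $ 3))\<^sup>2 * (v $ 3 * w $ 4 + v $ 4 * w $ 3)]"

lemma has_derivative_schwarzschild_christoffel:
  assumes "p \<in> schwarzschild_domain"
  shows "((\<lambda>q. schwarzschild_christoffel m q v w) has_derivative
      schwarzschild_christoffel_deriv m p v w) (at p)"
proof (rule has_derivative_vec)
  have p: "p $ 2 \<noteq> 0" "sin (p $ 3) \<noteq> 0" using assms by (auto simp: schwarzschild_domain_def)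
  \<comment> \<open>The quotient rule leaves a numerator with squares of both functions; the
    Pythagorean identity is spent here, once.\<close>
  have cot: "((\<lambda>q. cos (q $ 3) / sin (q $ 3)) has_derivative (\<lambda>x. - (x $ 3 / (sin (p $ 3))\<^sup>2))) (at p)"
    apply (rule derivative_eq_intros has_derivative_nth refl p)+
    using p sin_cos_squared_add[of "p $ 3"]
    by (simp add: fun_eq_iff divide_simps power2_eq_square)
      (simp add: algebra_simps flip: distrib_left)
  have "\<forall>i. ((\<lambda>q. schwarzschild_christoffel m q v w $ i) has_derivative
      (\<lambda>x. schwarzschild_christoffel_deriv m p v w x $ i)) (at p)"
    unfolding schwarzschild_christoffel_def schwarzschild_christoffel_deriv_def forall_4 vector_4
    apply (intro conjI;
        (rule cot derivative_eq_intros has_derivative_nth refl | use p in \<open>simp; fail\<close>)+)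
    using p
    by (simp_all add: divide_simps fun_eq_iff) (simp_all add: algebra_simps eval_nat_numeral)
  then show "((\<lambda>q. schwarzschild_christoffel m q v w $ i) has_derivative
      (\<lambda>x. schwarzschild_christoffel_deriv m p v w x $ i)) (at p)" for i by blast
qed


section \<open>The two blocks of the metric and the curvature tensor\<close>

definition block_h :: "real \<Rightarrow> real ^ 4 \<Rightarrow> real ^ 4 \<Rightarrow> real ^ 4 \<Rightarrow> real" where
  "block_h m p v w = - (1 - 2 * m / p $ 2) * (v $ 1 * w $ 1) - v $ 1 * w $ 2 - v $ 2 * w $ 1"

definition block_k :: "real ^ 4 \<Rightarrow> real ^ 4 \<Rightarrow> real ^ 4 \<Rightarrow> real" where
  "block_k p v w = (p $ 2)\<^sup>2 * (v $ 3 * w $ 3) + (p $ 2)\<^sup>2 * (sin (p $ 3))\<^sup>2 * (v $ 4 * w $ 4)"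

definition proj_h :: "real ^ 4 \<Rightarrow> real ^ 4" where
  "proj_h v = vector [v $ 1, v $ 2, 0, 0]"

definition proj_k :: "real ^ 4 \<Rightarrow> real ^ 4" where
  "proj_k v = vector [0, 0, v $ 3, v $ 4]"

lemma bilin_schwarzschild: "bilin (schwarzschild m p) v w = block_h m p v w + block_k p v w"
  by (simp add: bilin_def sum_4 schwarzschild_def block_h_def block_k_def algebra_simps)

text \<open>Stated for the endomorphism because \<open>curv_act\<close> inserts
  \<open>curv_op\<close> into the arguments of \<open>riemann\<close>; the projections make lowering
  the index a matter of \<open>block_proj\<close>.\<close>

lemma curv_op_schwarzschild:
  assumes U: "open U" "U \<subseteq> schwarzschild_domain" "p \<in> U"
    and X: "smooth_on U X" and Y: "smooth_on U Y" and Z: "smooth_on U Z"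
  shows "curv_op (schwarzschild m) X Y Z p = (m / p $ 2 ^ 3) *\<^sub>R
     ((block_k p (Y p) (Z p) - 2 * block_h m p (Y p) (Z p)) *\<^sub>R proj_h (X p)
    - (block_k p (X p) (Z p) - 2 * block_h m p (X p) (Z p)) *\<^sub>R proj_h (Y p)
    + (block_h m p (Y p) (Z p) - 2 * block_k p (Y p) (Z p)) *\<^sub>R proj_k (X p)
    - (block_h m p (X p) (Z p) - 2 * block_k p (X p) (Z p)) *\<^sub>R proj_k (Y p))"
proof -
  interpret smooth_christoffel U "schwarzschild m"
    by unfold_locales (intro U smooth_on_christoffel smooth_on_schwarzschild smooth_on_inv_schwarzschild)+
  have D: "p \<in> schwarzschild_domain" using U by blast
  have deriv: "frechet_derivative (\<lambda>q. christoffel_form (schwarzschild m) q v w) (at p)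
      = schwarzschild_christoffel_deriv m p v w" for v w
  proof -
    \<comment> \<open>A derivative at \<open>p\<close> needs the closed form on a neighbourhood,
      which \<open>U\<close> supplies.\<close>
    have "frechet_derivative (\<lambda>q. christoffel_form (schwarzschild m) q v w) (at p)
        = frechet_derivative (\<lambda>q. schwarzschild_christoffel m q v w) (at p)"
      using U by (intro frechet_derivative_cong_open[OF U(1,3)] christoffel_form_schwarzschild) blast
    then show ?thesis
      by (simp add: has_derivative_frechet[OF has_derivative_schwarzschild_christoffel[OF D]])
  qed
  have p: "p $ 2 \<noteq> 0" "sin (p $ 3) \<noteq> 0" using D by (auto simp: schwarzschild_domain_def)
  define r s c where "r = p $ 2" and "s = sin (p $ 3)" and "c = cos (p $ 3)"
  \<comment> \<open>Nested to fit the normal form of \<open>algebra_simps\<close>, this rule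
    eliminates squares of the cosine, so that with denominators cleared the components are
    polynomial identities.\<close>
  have cc: "c * (c * x) = x - s * (s * x)" for x
    using sin_cos_squared_add[of "p $ 3"]
    unfolding s_def[symmetric] c_def[symmetric] by algebra
  show ?thesis
    unfolding curv_op_coordinates[OF U(3) X Y Z] deriv christoffel_form_schwarzschild[OF D]
    apply (simp add: vec_eq_iff forall_4 schwarzschild_christoffel_def schwarzschild_christoffel_deriv_def
       block_h_def block_k_def proj_h_def proj_k_def)
    apply (fold r_def s_def c_def)
    using p[folded r_def s_def]
    by (intro conjI; simp add: divide_simps; simp add: algebra_simps eval_nat_numeral cc)
qed


lemma block_h_linear:
  "block_h m p (x + y) w = block_h m p x w + block_h m p y w"
  "block_h m p (x - y) w = block_h m p x w - block_h m p y w"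
  "block_h m p (a *\<^sub>R x) w = a * block_h m p x w"
  "block_h m p v (x + y) = block_h m p v x + block_h m p v y"
  "block_h m p v (x - y) = block_h m p v x - block_h m p v y"
  "block_h m p v (a *\<^sub>R x) = a * block_h m p v x"
  by (simp_all add: block_h_def algebra_simps)

lemma block_k_linear:
  "block_k p (x + y) w = block_k p x w + block_k p y w"
  "block_k p (x - y) w = block_k p x w - block_k p y w"
  "block_k p (a *\<^sub>R x) w = a * block_k p x w"
  "block_k p v (x + y) = block_k p v x + block_k p v y"
  "block_k p v (x - y) = block_k p v x - block_k p v y"
  "block_k p v (a *\<^sub>R x) = a * block_k p v x"
  by (simp_all add: block_k_def algebra_simps)

lemma block_proj:
  "block_h m p (proj_h v) w = block_h m p v w" "block_h m p (proj_k v) w = 0"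
  "block_k p (proj_h v) w = 0" "block_k p (proj_k v) w = block_k p v w"
  "block_h m p w (proj_h v) = block_h m p w v" "block_h m p w (proj_k v) = 0"
  "block_k p w (proj_h v) = 0" "block_k p w (proj_k v) = block_k p w v"
  by (simp_all add: block_h_def block_k_def proj_h_def proj_k_def)

lemma block_sym: "block_h m p v w = block_h m p w v" "block_k p v w = block_k p w v"
  by (simp_all add: block_h_def block_k_def algebra_simps)

text \<open>The factors 2 come from the squares \<open>h \<and> h\<close> and
  \<open>k \<and> k\<close>, whose four terms coincide in pairs.\<close>

definition schwarzschild_riemann ::
    "real \<Rightarrow> real ^ 4 \<Rightarrow> real ^ 4 \<Rightarrow> real ^ 4 \<Rightarrow> real ^ 4 \<Rightarrow> real ^ 4 \<Rightarrow> real" where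
  "schwarzschild_riemann m p x y z w = m / p $ 2 ^ 3 *
     (block_h m p x w * block_k p y z + block_h m p y z * block_k p x w
    - block_h m p x z * block_k p y w - block_h m p y w * block_k p x z
    - 2 * (block_h m p x w * block_h m p y z - block_h m p x z * block_h m p y w)
    - 2 * (block_k p x w * block_k p y z - block_k p x z * block_k p y w))"

lemma riemann_schwarzschild:
  assumes U: "open U" "U \<subseteq> schwarzschild_domain" "p \<in> U"
    and X: "smooth_on U X" and Y: "smooth_on U Y" and Z: "smooth_on U Z"
  shows "riemann (schwarzschild m) X Y Z W p = schwarzschild_riemann m p (X p) (Y p) (Z p) (W p)"
  unfolding riemann_def form2_def bilin_schwarzschild curv_op_schwarzschild[OF U X Y Z]
    block_h_linear block_k_linear block_proj schwarzschild_riemann_def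
  by (simp add: algebra_simps)

text \<open>Each block has trace 2. Up to the factor \<open>m / p $ 2 ^ 3\<close>, the mixed part
  contracts to \<open>2 h + 2 k\<close> and the squares to \<open>- 2 h - 2 k\<close>.\<close>

lemma schwarzschild_riemann_trace:
  assumes "p \<in> schwarzschild_domain"
  shows "(\<Sum>i\<in>UNIV. \<Sum>l\<in>UNIV. schwarzschild_inv m p $ i $ l *
     schwarzschild_riemann m p (axis i 1) y z (axis l 1)) = 0"
proof -
  have p: "p $ 2 \<noteq> 0" "sin (p $ 3) \<noteq> 0" using assms by (auto simp: schwarzschild_domain_def)
  show ?thesis using p
    by (simp add: sum_4 schwarzschild_inv_def schwarzschild_riemann_def block_h_def block_k_def axis_def)
      (simp add: divide_simps, simp add: algebra_simps)
qed

text \<open>The curvature endomorphisms \<open>x \<and>\<^sub>h y\<close> and \<open>x \<and>\<^sub>k y\<close> of the two blocks preserve \<open>h\<close> and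
  \<open>k\<close>, so only the mixed part \<open>m / r\<^sup>3\<close> of \<open>R\<close> acts, and it acts like that of \<open>x \<and>\<^sub>g y\<close>.\<close>

lemma schwarzschild_riemann_pseudosymmetric:
  fixes m :: real and p x y :: "real ^ 4"
  defines "T \<equiv> \<lambda>v. (m / p $ 2 ^ 3) *\<^sub>R
     ((block_k p y v - 2 * block_h m p y v) *\<^sub>R proj_h x
    - (block_k p x v - 2 * block_h m p x v) *\<^sub>R proj_h y
    + (block_h m p y v - 2 * block_k p y v) *\<^sub>R proj_k x
    - (block_h m p x v - 2 * block_k p x v) *\<^sub>R proj_k y)"
  defines "G \<equiv> \<lambda>v w. block_h m p v w + block_k p v w"
  defines "R \<equiv> schwarzschild_riemann m p"
  shows "- R (T x1) x2 x3 x4 - R x1 (T x2) x3 x4 - R x1 x2 (T x3) x4 - R x1 x2 x3 (T x4)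
    = m / p $ 2 ^ 3 *
      (G x x1 * R y x2 x3 x4 + G x x2 * R x1 y x3 x4 + G x x3 * R x1 x2 y x4 + G x x4 * R x1 x2 x3 y
     - G y x1 * R x x2 x3 x4 - G y x2 * R x1 x x3 x4 - G y x3 * R x1 x2 x x4 - G y x4 * R x1 x2 x3 x)"
proof -
  define \<beta> where "\<beta> = m / p $ 2 ^ 3"
  define h where "h = block_h m p"
  define k where "k = block_k p"
  have sym: "h v w = h w v" "k v w = k w v" for v w
    unfolding h_def k_def by (fact block_sym)+
  show ?thesis
    unfolding R_def T_def G_def schwarzschild_riemann_def block_h_linear block_k_linear block_proj
    unfolding \<beta>_def[symmetric] h_def[symmetric] k_def[symmetric]
    \<comment> \<open>One orientation per pair of arguments, so that \<open>algebra\<close> sees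
      each value of \<open>h\<close> and \<open>k\<close> as a single variable.\<close>
    unfolding sym[of x1 x] sym[of x1 y] sym[of x2 x] sym[of x2 y] sym[of x3 x] sym[of x3 y] sym[of x4 x] sym[of x4 y]
      sym[of x2 x1] sym[of x3 x1] sym[of x3 x2] sym[of x4 x1] sym[of x4 x2] sym[of x4 x3] sym[of y x]
    by algebra
qed

section \<open>Derivatives of the curvature and compatible tensors\<close>

text \<open>This is \<open>\<nabla>\<^sub>x h (y, z) = - \<nabla>\<^sub>x k (y, z)\<close>.\<close>

definition nabla_block :: "real ^ 4 \<Rightarrow> real ^ 4 \<Rightarrow> real ^ 4 \<Rightarrow> real ^ 4 \<Rightarrow> real" where
  "nabla_block p x y z = (block_k p x z * y $ 2 + block_k p x y * z $ 2) / p $ 2"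

text \<open>Product rule with \<open>NY\<close> and \<open>NZ\<close> as covariant derivatives. The
  blocks are not parallel because \<open>k\<close> is scaled by the square of \<open>r\<close>; the
  corrections are opposite because the sum \<open>g\<close> is parallel.\<close>

lemma has_derivative_block:
  fixes m :: real and p :: "real ^ 4"
  assumes D: "p \<in> schwarzschild_domain"
    and Y: "(Y has_derivative Y') (at p)" and Z: "(Z has_derivative Z') (at p)"
  defines "NY \<equiv> \<lambda>x. Y' x + schwarzschild_christoffel m p x (Y p)"
    and "NZ \<equiv> \<lambda>x. Z' x + schwarzschild_christoffel m p x (Z p)"
  shows "((\<lambda>q. block_h m q (Y q) (Z q)) has_derivative
      (\<lambda>x. block_h m p (NY x) (Z p) + block_h m p (Y p) (NZ x) + nabla_block p x (Y p) (Z p))) (at p)"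
    and "((\<lambda>q. block_k q (Y q) (Z q)) has_derivative
      (\<lambda>x. block_k p (NY x) (Z p) + block_k p (Y p) (NZ x) - nabla_block p x (Y p) (Z p))) (at p)"
proof -
  have p: "p $ 2 \<noteq> 0" "sin (p $ 3) \<noteq> 0" using D by (auto simp: schwarzschild_domain_def)
  note Yi = bounded_linear.has_derivative[OF bounded_linear_vec_nth Y]
  note Zi = bounded_linear.has_derivative[OF bounded_linear_vec_nth Z]
  show "((\<lambda>q. block_h m q (Y q) (Z q)) has_derivative
      (\<lambda>x. block_h m p (NY x) (Z p) + block_h m p (Y p) (NZ x) + nabla_block p x (Y p) (Z p))) (at p)"
    unfolding block_h_def
    apply (rule derivative_eq_intros has_derivative_nth Yi Zi refl | use p in \<open>simp; fail\<close>)+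
    using p
    by (simp add: fun_eq_iff NY_def NZ_def schwarzschild_christoffel_def block_k_def block_h_def nabla_block_def
        divide_simps) (simp add: algebra_simps eval_nat_numeral)
  show "((\<lambda>q. block_k q (Y q) (Z q)) has_derivative
      (\<lambda>x. block_k p (NY x) (Z p) + block_k p (Y p) (NZ x) - nabla_block p x (Y p) (Z p))) (at p)"
    unfolding block_k_def
    apply (rule derivative_eq_intros has_derivative_nth Yi Zi refl | use p in \<open>simp; fail\<close>)+
    using p
    by (simp add: fun_eq_iff NY_def NZ_def schwarzschild_christoffel_def block_k_def nabla_block_def
        divide_simps) (simp add: algebra_simps eval_nat_numeral)
qed

text \<open>The first summand differentiates \<open>m / p $ 2 ^ 3\<close>. For the second,
  \<open>\<nabla>h = N\<close> and \<open>\<nabla>k = - N\<close> give \<open>\<nabla>(h \<and> k -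
  h \<and> h - k \<and> k) = 3 N \<and> (k - h)\<close>.\<close>

definition nabla_schwarzschild_riemann ::
    "real \<Rightarrow> real ^ 4 \<Rightarrow> real ^ 4 \<Rightarrow> real ^ 4 \<Rightarrow> real ^ 4 \<Rightarrow> real ^ 4 \<Rightarrow> real ^ 4 \<Rightarrow> real" where
  "nabla_schwarzschild_riemann m p v x y z w =
     - 3 * v $ 2 / p $ 2 * schwarzschild_riemann m p x y z w
     + 3 * (m / p $ 2 ^ 3) *
       (nabla_block p v x w * (block_k p y z - block_h m p y z)
      + nabla_block p v y z * (block_k p x w - block_h m p x w)
      - nabla_block p v x z * (block_k p y w - block_h m p y w)
      - nabla_block p v y w * (block_k p x z - block_h m p x z))"

lemma has_derivative_schwarzschild_riemann:
  fixes m :: real and p :: "real ^ 4"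
  assumes D: "p \<in> schwarzschild_domain"
    and X: "(X has_derivative X') (at p)" and Y: "(Y has_derivative Y') (at p)"
    and Z: "(Z has_derivative Z') (at p)" and W: "(W has_derivative W') (at p)"
  defines "N \<equiv> \<lambda>A A' v. A' v + schwarzschild_christoffel m p v (A p)"
  shows "((\<lambda>q. schwarzschild_riemann m q (X q) (Y q) (Z q) (W q)) has_derivative
      (\<lambda>v. schwarzschild_riemann m p (N X X' v) (Y p) (Z p) (W p)
         + schwarzschild_riemann m p (X p) (N Y Y' v) (Z p) (W p)
         + schwarzschild_riemann m p (X p) (Y p) (N Z Z' v) (W p)
         + schwarzschild_riemann m p (X p) (Y p) (Z p) (N W W' v)
         + nabla_schwarzschild_riemann m p v (X p) (Y p) (Z p) (W p))) (at p)"
proof -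
  have p: "p $ 2 \<noteq> 0" using D by (auto simp: schwarzschild_domain_def)
  define t \<beta> where "t = inverse (p $ 2)" and "\<beta> = m / p $ 2 ^ 3"
  have \<beta>: "((\<lambda>q. m / q $ 2 ^ 3) has_derivative (\<lambda>v. - 3 * v $ 2 * t * \<beta>)) (at p)"
    apply (rule derivative_eq_intros has_derivative_nth refl | use p in \<open>simp; fail\<close>)+
    using p by (simp add: fun_eq_iff t_def \<beta>_def divide_simps, simp add: algebra_simps eval_nat_numeral)
  note d = has_derivative_block[OF D, where m = m]
  show ?thesis
    unfolding schwarzschild_riemann_def nabla_schwarzschild_riemann_def
    apply (rule \<beta> d(1)[OF X Z] d(1)[OF X W] d(1)[OF Y Z] d(1)[OF Y W]
      d(2)[OF X Z] d(2)[OF X W] d(2)[OF Y Z] d(2)[OF Y W] derivative_eq_intros refl)+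
    \<comment> \<open>With \<open>\<beta>\<close> and \<open>t\<close> in place of the quotients, a
      polynomial identity remains.\<close>
    unfolding \<beta>_def[symmetric] divide_inverse[of _ "p $ 2"] t_def[symmetric]
    unfolding N_def
    by (simp add: fun_eq_iff) (simp add: algebra_simps)
qed

text \<open>The first summand contracts to \<open>- 3 / r\<close> times the curvature with the
  gradient of \<open>r\<close> inserted. In the second, \<open>k\<close> has trace 2 and
  \<open>dr\<close> contracts with \<open>k\<close> to zero, which leaves the same expression with
  the opposite sign.\<close>

lemma nabla_schwarzschild_riemann_trace:
  assumes "p \<in> schwarzschild_domain"
  shows "(\<Sum>q\<in>UNIV. \<Sum>i\<in>UNIV. schwarzschild_inv m p $ q $ i *
     nabla_schwarzschild_riemann m p (axis q 1) (axis i 1) x y z) = 0"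
proof -
  have p: "p $ 2 \<noteq> 0" "sin (p $ 3) \<noteq> 0" using assms by (auto simp: schwarzschild_domain_def)
  show ?thesis using p
    by (simp add: sum_4 schwarzschild_inv_def nabla_schwarzschild_riemann_def nabla_block_def
        schwarzschild_riemann_def block_h_def block_k_def axis_def)
      (simp add: divide_simps, simp add: algebra_simps eval_nat_numeral)
qed

section \<open>The endomorphism of a symmetric tensor\<close>

lemma bilin_vector_matrix: "bilin M v w = (v v* M) \<bullet> w"
  unfolding bilin_def vector_matrix_mult_def inner_vec_def
  by (subst sum.swap) (simp add: sum_distrib_left mult_ac)

text \<open>Testing against all \<open>w\<close> turns the condition in \<open>endo\<close> into a
  linear equation for a row vector, which an invertible metric solves uniquely.\<close>

lemma endo_eq:
  assumes "invertible (g p)"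
  shows "endo g E X p = X p v* E p v* inv_metric g p"
proof -
  have I: "g p ** matrix_inv (g p) = mat 1" "matrix_inv (g p) ** g p = mat 1"
    using assms unfolding invertible_def matrix_inv_def by (metis (mono_tags, lifting) someI_ex)+
  have "(\<forall>w. bilin (g p) v w = bilin (E p) (X p) w) \<longleftrightarrow> v v* g p = X p v* E p" for v
    unfolding bilin_vector_matrix by (metis vector_eq_rdot)
  also have "v v* g p = X p v* E p \<longleftrightarrow> v = X p v* E p v* inv_metric g p" for v
    by (metis I vector_matrix_mul_assoc vector_matrix_mul_rid)
  finally show ?thesis unfolding endo_def by simp
qed

lemma bilin_endo:
  assumes "invertible (g p)"
  shows "bilin (g p) (endo g E X p) w = bilin (E p) (X p) w"
proof -
  have I: "matrix_inv (g p) ** g p = mat 1"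
    using assms unfolding invertible_def matrix_inv_def by (metis (mono_tags, lifting) someI_ex)
  show ?thesis
    by (simp add: bilin_vector_matrix endo_eq[where g = g and p = p, OF assms] vector_matrix_mul_assoc I
        flip: matrix_mul_assoc)
qed

lemma invertible_schwarzschild:
  assumes "p \<in> schwarzschild_domain"
  shows "invertible (schwarzschild m p)"
  using schwarzschild_times_inv[OF assms] invertible_right_inverse by blast

text \<open>Since \<open>h(v, w) = g(v, proj_h w)\<close>, and likewise for \<open>k\<close>, the
  blocks see the endomorphism only through \<open>E\<close>; no inverse metric enters the curvature
  terms.\<close>

lemma block_endo_schwarzschild:
  assumes "p \<in> schwarzschild_domain"
  shows "block_h m p (endo (schwarzschild m) E X p) w = bilin (E p) (X p) (proj_h w)"
    and "block_k p (endo (schwarzschild m) E X p) w = bilin (E p) (X p) (proj_k w)"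
  using bilin_endo[where g = "schwarzschild m" and p = p, OF invertible_schwarzschild[OF assms], of E X "proj_h w"]
    bilin_endo[where g = "schwarzschild m" and p = p, OF invertible_schwarzschild[OF assms], of E X "proj_k w"]
  by (simp_all add: bilin_schwarzschild block_proj)

text \<open>Compatibility puts \<open>endo\<close> into the first argument of
  \<open>riemann\<close>, where the pointwise formula asks for a smooth field.\<close>

lemma smooth_on_endo_schwarzschild:
  assumes "open U" "U \<subseteq> schwarzschild_domain" "smooth_on U E" "smooth_on U X"
  shows "smooth_on U (endo (schwarzschild m) E X)"
proof -
  have "smooth_on U (\<lambda>p. X p v* E p v* inv_metric (schwarzschild m) p)"
    by (rule smooth_on_vec[OF assms(1)], simp add: vector_matrix_mult_def)
      (intro smooth_on_sum smooth_on_mult smooth_on_inv_schwarzschild smooth_on_nth assms)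
  moreover have "endo (schwarzschild m) E X p = X p v* E p v* inv_metric (schwarzschild m) p"
    if "p \<in> U" for p
    using that assms(2) by (intro endo_eq invertible_schwarzschild) blast
  ultimately show ?thesis by (subst smooth_on_cong[OF assms(1)])
qed

lemma coord_field_apply: "coord_field i p = axis i 1"
  by (simp add: coord_field_def)

lemma smooth_on_coord_field: "smooth_on U (coord_field i)"
  unfolding coord_field_def by (rule smooth_on_const)

section \<open>Ricci flatness, divergence and pseudosymmetry\<close>

context
  fixes m :: real and U :: "(real ^ 4) set"
  assumes U: "open U" "U \<subseteq> schwarzschild_domain"
begin

interpretation smooth_christoffel U "schwarzschild m"
  by unfold_locales (intro U smooth_on_christoffel smooth_on_schwarzschild smooth_on_inv_schwarzschild)+

lemma ricci_schwarzschild: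
  assumes p: "p \<in> U" and Y: "smooth_on U Y" and Z: "smooth_on U Z"
  shows "ricci (schwarzschild m) Y Z p = 0"
  unfolding ricci_def riemann_schwarzschild[OF U p smooth_on_coord_field Y Z]
  using schwarzschild_riemann_trace U p
  by (subst inv_metric_schwarzschild) (auto simp: coord_field_def)

lemma scalar_curv_schwarzschild: "p \<in> U \<Longrightarrow> scalar_curv (schwarzschild m) p = 0"
  unfolding scalar_curv_def by (simp add: ricci_schwarzschild smooth_on_coord_field)

lemma riemann_eq_curvatures:
  "tensor4_eq_on U (riemann (schwarzschild m)) (projective (schwarzschild m))"
  "tensor4_eq_on U (riemann (schwarzschild m)) (concircular (schwarzschild m))"
  "tensor4_eq_on U (riemann (schwarzschild m)) (conformal (schwarzschild m))"
  "tensor4_eq_on U (riemann (schwarzschild m)) (conharmonic (schwarzschild m))"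
  unfolding tensor4_eq_on_def
  by (simp_all add: projective_def concircular_def conformal_def conharmonic_def wedge4_def
      wedge_op_def form2_def bilin_def kulkarni_nomizu_def ricci_schwarzschild scalar_curv_schwarzschild)

text \<open>Differentiating the curvature produces four terms with a covariantly differentiated
  argument, exactly those that \<open>nabla4\<close> subtracts. The formula for
  \<open>riemann\<close> applies to them because \<open>nabla\<close> keeps fields smooth.\<close>

lemma nabla4_schwarzschild:
  assumes p: "p \<in> U" and V: "smooth_on U V" and X: "smooth_on U X" and Y: "smooth_on U Y"
    and Z: "smooth_on U Z" and W: "smooth_on U W"
  shows "nabla4 (schwarzschild m) (riemann (schwarzschild m)) V X Y Z W p =
    nabla_schwarzschild_riemann m p (V p) (X p) (Y p) (Z p) (W p)"
proof -
  have D: "p \<in> schwarzschild_domain" using p U by blast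
  have "frechet_derivative (riemann (schwarzschild m) X Y Z W) (at p)
      = frechet_derivative (\<lambda>q. schwarzschild_riemann m q (X q) (Y q) (Z q) (W q)) (at p)"
    by (rule frechet_derivative_cong_open[OF U(1) p]) (rule riemann_schwarzschild[OF U _ X Y Z])
  note * = this[unfolded has_derivative_frechet[OF has_derivative_schwarzschild_riemann[OF D
      smooth_on_has_derivative[OF X p] smooth_on_has_derivative[OF Y p]
      smooth_on_has_derivative[OF Z p] smooth_on_has_derivative[OF W p]]]]
  show ?thesis
    unfolding nabla4_def dir_deriv_def *
    by (simp add: riemann_schwarzschild[OF U p] X Y Z V smooth_on_nabla nabla_christoffel_form
        christoffel_form_schwarzschild[OF D])
qed

lemma harmonic_curv_schwarzschild: "harmonic_curv U (schwarzschild m)"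
  unfolding harmonic_curv_def
proof (intro allI impI ballI)
  fix X Y Z :: "real ^ 4 \<Rightarrow> real ^ 4" and p assume *: "smooth_on U X \<and> smooth_on U Y \<and> smooth_on U Z" and p: "p \<in> U"
  show "div_riemann (schwarzschild m) X Y Z p = 0"
    using nabla_schwarzschild_riemann_trace[of p m] U p *
    by (auto simp: div_riemann_def nabla4_schwarzschild smooth_on_coord_field
        inv_metric_schwarzschild coord_field_apply subset_iff)
qed

lemma pseudosymmetric_schwarzschild:
  "pseudosymmetric_with U (schwarzschild m) (\<lambda>x. m / (x $ 2) ^ 3)"
  unfolding pseudosymmetric_with_def
proof (intro allI impI ballI, elim conjE)
  fix X1 X2 X3 X4 X Y :: "real ^ 4 \<Rightarrow> real ^ 4" and p
  assume s: "smooth_on U X1" "smooth_on U X2" "smooth_on U X3" "smooth_on U X4" "smooth_on U X" "smooth_on U Y"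
    and p: "p \<in> U"
  note [simp] = riemann_schwarzschild[OF U p]
  show "curv_act (schwarzschild m) (riemann (schwarzschild m)) X1 X2 X3 X4 X Y p
      = m / p $ 2 ^ 3 * tachibana (schwarzschild m) (riemann (schwarzschild m)) X1 X2 X3 X4 X Y p"
    unfolding curv_act_def tachibana_def form2_def bilin_schwarzschild
    using schwarzschild_riemann_pseudosymmetric[where m = m and p = p and x = "X p" and y = "Y p" and
        ?x1.0 = "X1 p" and ?x2.0 = "X2 p" and ?x3.0 = "X3 p" and ?x4.0 = "X4 p"]
    by (simp add: s smooth_on_curv_op curv_op_schwarzschild[OF U p])
qed

lemma deszcz_pseudosymmetric_schwarzschild: "deszcz_pseudosymmetric U (schwarzschild m)"
  unfolding deszcz_pseudosymmetric_def
proof (intro exI conjI)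
  show "smooth_on U (\<lambda>x. m / (x $ 2) ^ 3)"
    using U(2) by (intro smooth_on_divide smooth_on_const smooth_on_power smooth_on_coord U(1))
      (auto simp: schwarzschild_domain_def)
qed (rule pseudosymmetric_schwarzschild)

lemma compatible_tensor_schwarzschild_iff:
  "compatible_tensor U (schwarzschild m) E \<longleftrightarrow> symmetric_tensor2_on U E \<and>
     (\<forall>X X1 X2 X3. smooth_on U X \<and> smooth_on U X1 \<and> smooth_on U X2 \<and> smooth_on U X3 \<longrightarrow> (\<forall>p\<in>U.
       schwarzschild_riemann m p (endo (schwarzschild m) E X1 p) (X p) (X2 p) (X3 p)
     + schwarzschild_riemann m p (endo (schwarzschild m) E X2 p) (X p) (X3 p) (X1 p)
     + schwarzschild_riemann m p (endo (schwarzschild m) E X3 p) (X p) (X1 p) (X2 p) = 0))"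
  unfolding compatible_tensor_def symmetric_tensor2_on_def
  by (auto simp: riemann_schwarzschild[OF U] smooth_on_endo_schwarzschild[OF U])

end

section \<open>Compatible tensors\<close>

lemma compatible_imp_block:
  assumes m: "m \<noteq> 0" and U: "open U" "U \<subseteq> schwarzschild_domain" and p: "p \<in> U"
    and E: "compatible_tensor U (schwarzschild m) E"
  shows "E p = vector [vector [E p $ 1 $ 1, E p $ 1 $ 2, 0, 0],
                       vector [E p $ 1 $ 2, E p $ 2 $ 2, 0, 0],
                       vector [0, 0, E p $ 3 $ 3, E p $ 3 $ 4],
                       vector [0, 0, E p $ 3 $ 4, E p $ 4 $ 4]]"
proof -
  have D: "p \<in> schwarzschild_domain" using p U by blast
  then have nz: "p $ 2 \<noteq> 0" by (auto simp: schwarzschild_domain_def)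
  have "transpose (E p) = E p"
    using E p by (simp add: compatible_tensor_def symmetric_tensor2_on_def)
  then have sym: "E p $ i $ j = E p $ j $ i" for i j
    by (simp add: transpose_def vec_eq_iff)
  define R where "R i j k l = schwarzschild_riemann m p (endo (schwarzschild m) E (coord_field i) p)
      (axis j 1) (axis k 1) (axis l 1)" for i j k l
  have compat: "R i j k l + R k j l i + R l j i k = 0" for i j k l
    using conjunct2[OF E[unfolded compatible_tensor_schwarzschild_iff[OF U]], rule_format,
        of "coord_field j" "coord_field i" "coord_field k" "coord_field l" p] p
    unfolding R_def coord_field_apply by (simp add: smooth_on_const)
  note R = R_def schwarzschild_riemann_def block_endo_schwarzschild[OF D]
  note simps = bilin_def sum_4 coord_field_apply proj_h_def proj_k_def block_h_def block_k_def axis_def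
  note sym = sym[of 2 1] sym[of 3 1] sym[of 3 2] sym[of 4 1] sym[of 4 2] sym[of 4 3]
  \<comment> \<open>The coordinate field along \<open>r\<close> is null, so each cyclic sum reduces
    to one component of \<open>E\<close>, counted twice by \<open>h \<and> h\<close> and once by the
    mixed part.\<close>
  have "E p $ 2 $ 3 = 0" "E p $ 2 $ 4 = 0"
    using compat[of 3 2 1 2, unfolded R] compat[of 4 2 1 2, unfolded R] m nz by (simp_all add: simps sym)
  \<comment> \<open>These sums also contain the components just removed, multiplied by
    \<open>h\<close> of the \<open>u\<close> field with itself; hence the order.\<close>
  moreover from this have "E p $ 1 $ 3 = 0" "E p $ 1 $ 4 = 0"
    using compat[of 3 1 1 2, unfolded R] compat[of 4 1 1 2, unfolded R] m nz by (simp_all add: simps sym)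
  ultimately show ?thesis
    by (simp add: vec_eq_iff forall_4 sym)
qed

lemma block_imp_compatible:
  assumes U: "open U" "U \<subseteq> schwarzschild_domain"
    and a: "smooth_on U a11" "smooth_on U a12" "smooth_on U a22"
      "smooth_on U a33" "smooth_on U a34" "smooth_on U a44"
    and E: "\<And>p. p \<in> U \<Longrightarrow> E p = vector [vector [a11 p, a12 p, 0, 0],
                                vector [a12 p, a22 p, 0, 0],
                                vector [0, 0, a33 p, a34 p],
                                vector [0, 0, a34 p, a44 p]]"
  shows "compatible_tensor U (schwarzschild m) E"
  unfolding compatible_tensor_schwarzschild_iff[OF U] symmetric_tensor2_on_def
proof (intro conjI allI impI ballI)
  let ?E = "\<lambda>p. vector [vector [a11 p, a12 p, 0, 0], vector [a12 p, a22 p, 0, 0],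
      vector [0, 0, a33 p, a34 p], vector [0, 0, a34 p, a44 p]] :: real ^ 4 ^ 4"
  have "\<forall>i j. smooth_on U (\<lambda>p. ?E p $ i $ j)"
    unfolding forall_4 vector_4 by (intro conjI a smooth_on_const)
  then have "smooth_on U ?E" by (intro smooth_on_vec U) blast
  then show "smooth_on U E" using E by (subst smooth_on_cong[OF U(1)])
  show "transpose (E p) = E p" if "p \<in> U" for p
    by (simp add: E[OF that] transpose_def vec_eq_iff forall_4)
  fix X X1 X2 X3 :: "real ^ 4 \<Rightarrow> real ^ 4" and p assume p: "p \<in> U"
  have D: "p \<in> schwarzschild_domain" using p U by blast
  \<comment> \<open>The zero mixed entries enter here: projecting either argument to a block gives
    the same value.\<close>
  have sym: "bilin (E p) v (proj_h w) = bilin (E p) w (proj_h v)"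
    "bilin (E p) v (proj_k w) = bilin (E p) w (proj_k v)" for v w
    by (simp_all add: E[OF p] bilin_def sum_4 proj_h_def proj_k_def algebra_simps)
  show "schwarzschild_riemann m p (endo (schwarzschild m) E X1 p) (X p) (X2 p) (X3 p)
     + schwarzschild_riemann m p (endo (schwarzschild m) E X2 p) (X p) (X3 p) (X1 p)
     + schwarzschild_riemann m p (endo (schwarzschild m) E X3 p) (X p) (X1 p) (X2 p) = 0"
    unfolding schwarzschild_riemann_def block_endo_schwarzschild[OF D]
      sym[of "X2 p" "X1 p"] sym[of "X3 p" "X1 p"] sym[of "X3 p" "X2 p"]
    by (simp add: algebra_simps)
qed

theorem corollary4p1:
  fixes m :: real and U :: "(real ^ 4) set"
  assumes "m \<noteq> 0" and "open U" and "U \<subseteq> schwarzschild_domain"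
  shows
    "(ricci_flat U (schwarzschild m) \<and>
      tensor4_eq_on U (riemann (schwarzschild m)) (projective (schwarzschild m)) \<and>
      tensor4_eq_on U (riemann (schwarzschild m)) (concircular (schwarzschild m)) \<and>
      tensor4_eq_on U (riemann (schwarzschild m)) (conformal (schwarzschild m)) \<and>
      tensor4_eq_on U (riemann (schwarzschild m)) (conharmonic (schwarzschild m))) \<and>
     harmonic_curv U (schwarzschild m) \<and>
     (deszcz_pseudosymmetric U (schwarzschild m) \<and>
      pseudosymmetric_with U (schwarzschild m) (\<lambda>x. m / (x $ 2) ^ 3)) \<and>
     (\<forall>E :: 4 matrix_field. compatible_tensor U (schwarzschild m) E \<longleftrightarrow>
        (\<exists>a11 a12 a22 a33 a34 a44.
           smooth_on U a11 \<and> smooth_on U a12 \<and> smooth_on U a22 \<and>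
           smooth_on U a33 \<and> smooth_on U a34 \<and> smooth_on U a44 \<and>
           (\<forall>p\<in>U. E p = vector [vector [a11 p, a12 p, 0, 0],
                                vector [a12 p, a22 p, 0, 0],
                                vector [0, 0, a33 p, a34 p],
                                vector [0, 0, a34 p, a44 p]])))"
proof (intro conjI allI)
  note U = assms(2,3)
  show "ricci_flat U (schwarzschild m)"
    by (simp add: ricci_flat_def ricci_schwarzschild[OF U])
  fix E :: "4 matrix_field"
  show "compatible_tensor U (schwarzschild m) E \<longleftrightarrow>
        (\<exists>a11 a12 a22 a33 a34 a44.
           smooth_on U a11 \<and> smooth_on U a12 \<and> smooth_on U a22 \<and>
           smooth_on U a33 \<and> smooth_on U a34 \<and> smooth_on U a44 \<and>
           (\<forall>p\<in>U. E p = vector [vector [a11 p, a12 p, 0, 0],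
                                vector [a12 p, a22 p, 0, 0],
                                vector [0, 0, a33 p, a34 p],
                                vector [0, 0, a34 p, a44 p]]))" (is "_ \<longleftrightarrow> ?B")
  proof
    assume E: "compatible_tensor U (schwarzschild m) E"
    then have "smooth_on U E" by (simp add: compatible_tensor_def symmetric_tensor2_on_def)
    \<comment> \<open>The entries of \<open>E\<close> serve as the coefficient fields.\<close>
    then have "smooth_on U (\<lambda>p. E p $ i $ j)" for i j by (intro smooth_on_nth U)
    then show ?B using compatible_imp_block[OF assms(1) U _ E] by blast
  next
    assume ?B
    then show "compatible_tensor U (schwarzschild m) E" by (elim exE conjE) (rule block_imp_compatible[OF U]; blast)
  qed
qed (rule riemann_eq_curvatures[OF assms(2,3)] harmonic_curv_schwarzschild[OF assms(2,3)]
    deszcz_pseudosymmetric_schwarzschild[OF assms(2,3)] pseudosymmetric_schwarzschild[OF assms(2,3)])+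

end
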